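(* There exist a discrete group $G$ and a metrizable hereditarily amenable $G$-flow $(X,G)$ such that the flow $(E(X,G),G)$ is not amenable.
   Context: All compact spaces are Hausdorff. A $G$-flow $(X,G)$ is a compact space $X$ with an action of the discrete group $G$ by homeomorphisms; it is metrizable if $X$ is. A subflow is a nonempty closed $G$-invariant subset with the restricted action. A flow is amenable if it carries a $G$-invariant regular Borel probability measure, and hereditarily amenable if every subflow is amenable. The enveloping semigroup $E(X,G)$ is the closure of $\{g_X:g\in G\}$ in $X^X$ with the product topology, where $g_X(x)=gx$; it is a $G$-flow under $g\cdot p:=g_X\circ p$. *)

theory Defs
  imports "HOL-Algebra.Group_Action" "HOL-Probability.Probability"
begin

(* HOL has no existential quantifier over types, so an existence statement about metrizable flows
   must name carrier types. With G :: "real monoid" and X :: "(nat \<Rightarrow> real) topology" (the topology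
   is arbitrary, on an arbitrary subset) nothing is lost: a compact metrizable space has at most
   continuum many points, so it can be transported to this type; replacing G by its image in
   Homeo(X) changes neither subflows, nor invariant measures, nor the enveloping semigroup, and
   Homeo(X) has at most continuum many elements, as X is separable. *)

(* HOL-Algebra's group_action takes values in BijGroup (topspace X), so every "\<phi> g" is an
   extensional function: it is "undefined" outside the carrier of X. Hence restricted actions are
   formed with "restrict", and "\<phi> g" is literally an element of the carrier of X^X below. *)
definition flow :: "('g, 'm) monoid_scheme \<Rightarrow> 'x topology \<Rightarrow> ('g \<Rightarrow> 'x \<Rightarrow> 'x) \<Rightarrow> bool" where
  "flow G X \<phi> \<longleftrightarrow>
     compact_space X \<and> Hausdorff_space X \<and>
     group_action G (topspace X) \<phi> \<and>
     (\<forall>g\<in>carrier G. homeomorphic_map X X (\<phi> g))"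

definition subflow ::
  "('g, 'm) monoid_scheme \<Rightarrow> 'x topology \<Rightarrow> ('g \<Rightarrow> 'x \<Rightarrow> 'x) \<Rightarrow> 'x set \<Rightarrow> bool" where
  "subflow G X \<phi> S \<longleftrightarrow>
     S \<noteq> {} \<and> closedin X S \<and> (\<forall>g\<in>carrier G. \<phi> g ` S \<subseteq> S)"

definition regular_borel_probability :: "'x topology \<Rightarrow> 'x measure \<Rightarrow> bool" where
  "regular_borel_probability X M \<longleftrightarrow>
     sets M = sets (sigma (topspace X) {U. openin X U}) \<and>
     prob_space M \<and>
     (\<forall>A\<in>sets M.
        emeasure M A = (SUP K\<in>{K. compactin X K \<and> K \<subseteq> A}. emeasure M K) \<and>
        emeasure M A = (INF U\<in>{U. openin X U \<and> A \<subseteq> U}. emeasure M U))"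

definition amenable_flow ::
  "('g, 'm) monoid_scheme \<Rightarrow> 'x topology \<Rightarrow> ('g \<Rightarrow> 'x \<Rightarrow> 'x) \<Rightarrow> bool" where
  "amenable_flow G X \<phi> \<longleftrightarrow>
     (\<exists>M. regular_borel_probability X M \<and>
        (\<forall>g\<in>carrier G. \<forall>A\<in>sets M. emeasure M (\<phi> g ` A) = emeasure M A))"

definition hereditarily_amenable_flow ::
  "('g, 'm) monoid_scheme \<Rightarrow> 'x topology \<Rightarrow> ('g \<Rightarrow> 'x \<Rightarrow> 'x) \<Rightarrow> bool" where
  "hereditarily_amenable_flow G X \<phi> \<longleftrightarrow>
     (\<forall>S. subflow G X \<phi> S \<longrightarrow>
        amenable_flow G (subtopology X S) (\<lambda>g. restrict (\<phi> g) S))"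

definition enveloping_semigroup ::
  "('g, 'm) monoid_scheme \<Rightarrow> 'x topology \<Rightarrow> ('g \<Rightarrow> 'x \<Rightarrow> 'x) \<Rightarrow> ('x \<Rightarrow> 'x) set" where
  "enveloping_semigroup G X \<phi> =
     product_topology (\<lambda>_. X) (topspace X) closure_of (\<phi> ` carrier G)"

definition enveloping_topology ::
  "('g, 'm) monoid_scheme \<Rightarrow> 'x topology \<Rightarrow> ('g \<Rightarrow> 'x \<Rightarrow> 'x) \<Rightarrow> ('x \<Rightarrow> 'x) topology" where
  "enveloping_topology G X \<phi> =
     subtopology (product_topology (\<lambda>_. X) (topspace X)) (enveloping_semigroup G X \<phi>)"

definition enveloping_action ::
  "('g, 'm) monoid_scheme \<Rightarrow> 'x topology \<Rightarrow> ('g \<Rightarrow> 'x \<Rightarrow> 'x) \<Rightarrow> 'g \<Rightarrow> ('x \<Rightarrow> 'x) \<Rightarrow> ('x \<Rightarrow> 'x)" where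
  "enveloping_action G X \<phi> g =
     (\<lambda>p\<in>enveloping_semigroup G X \<phi>. compose (topspace X) (\<phi> g) p)"

lemma flowI:
  assumes G: "group G" and X: "compact_space X" "Hausdorff_space X"
    and ext: "\<And>g. g \<in> carrier G \<Longrightarrow> \<psi> g \<in> extensional (topspace X)"
    and cont: "\<And>g. g \<in> carrier G \<Longrightarrow> continuous_map X X (\<psi> g)"
    and one: "\<And>x. x \<in> topspace X \<Longrightarrow> \<psi> \<one>\<^bsub>G\<^esub> x = x"
    and mult: "\<And>g h x. g \<in> carrier G \<Longrightarrow> h \<in> carrier G \<Longrightarrow> x \<in> topspace X \<Longrightarrow>
      \<psi> (g \<otimes>\<^bsub>G\<^esub> h) x = \<psi> g (\<psi> h x)"
  shows "flow G X \<psi>"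
proof -
  interpret group G by fact
  have maps: "homeomorphic_maps X X (\<psi> g) (\<psi> (inv\<^bsub>G\<^esub> g))" if "g \<in> carrier G" for g
    unfolding homeomorphic_maps_def
  proof (intro conjI ballI)
    show "\<psi> (inv\<^bsub>G\<^esub> g) (\<psi> g x) = x" if "x \<in> topspace X" for x
      using mult[of "inv\<^bsub>G\<^esub> g" g x] one that \<open>g \<in> carrier G\<close> by simp
    show "\<psi> g (\<psi> (inv\<^bsub>G\<^esub> g) x) = x" if "x \<in> topspace X" for x
      using mult[of g "inv\<^bsub>G\<^esub> g" x] one that \<open>g \<in> carrier G\<close> by simp
  qed (use that cont in auto)
  then have homeo: "homeomorphic_map X X (\<psi> g)" if "g \<in> carrier G" for g
    using that homeomorphic_map_maps by blast
  have bij: "\<psi> g \<in> Bij (topspace X)" if "g \<in> carrier G" for g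
    using homeo[OF that] ext[OF that]
    by (simp add: Bij_def bij_betw_def homeomorphic_imp_injective_map
          homeomorphic_imp_surjective_map)
  have "\<psi> (g \<otimes>\<^bsub>G\<^esub> h) = compose (topspace X) (\<psi> g) (\<psi> h)" if "g \<in> carrier G" "h \<in> carrier G" for g h
    by (rule extensionalityI[where A="topspace X"])
      (use that mult ext in \<open>auto simp: compose_def\<close>)
  then have "\<psi> \<in> hom G (BijGroup (topspace X))"
    using bij by (auto simp: hom_def BijGroup_def)
  then have "group_action G (topspace X) \<psi>"
    by (simp add: group_action_def group_hom_def group_hom_axioms_def group_BijGroup group_axioms)
  then show ?thesis
    using X homeo by (simp add: flow_def)
qed

lemma flowD:
  assumes "flow G X \<phi>"
  shows "group G" "compact_space X" "Hausdorff_space X"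
    and "\<And>g. g \<in> carrier G \<Longrightarrow> \<phi> g \<in> extensional (topspace X)"
    and "\<And>g. g \<in> carrier G \<Longrightarrow> continuous_map X X (\<phi> g)"
    and "\<And>x. x \<in> topspace X \<Longrightarrow> \<phi> \<one>\<^bsub>G\<^esub> x = x"
    and "\<And>g h x. g \<in> carrier G \<Longrightarrow> h \<in> carrier G \<Longrightarrow> x \<in> topspace X \<Longrightarrow>
      \<phi> (g \<otimes>\<^bsub>G\<^esub> h) x = \<phi> g (\<phi> h x)"
proof -
  interpret group_action G "topspace X" \<phi>
    using assms by (simp add: flow_def)
  show "group G" using group_hom by (simp add: group_hom_def)
  show "compact_space X" "Hausdorff_space X" using assms by (auto simp: flow_def)
  show "\<And>g. g \<in> carrier G \<Longrightarrow> \<phi> g \<in> extensional (topspace X)"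
    using bij_prop0 by (simp add: Bij_def)
  show "\<And>g. g \<in> carrier G \<Longrightarrow> continuous_map X X (\<phi> g)"
    using assms by (simp add: flow_def homeomorphic_imp_continuous_map)
  show "\<And>x. x \<in> topspace X \<Longrightarrow> \<phi> \<one>\<^bsub>G\<^esub> x = x"
    by (metis id_eq_one restrict_apply')
  show "\<And>g h x. g \<in> carrier G \<Longrightarrow> h \<in> carrier G \<Longrightarrow> x \<in> topspace X \<Longrightarrow>
      \<phi> (g \<otimes>\<^bsub>G\<^esub> h) x = \<phi> g (\<phi> h x)"
    using composition_rule by blast
qed

lemma flow_subflow:
  assumes F: "flow G X \<phi>" and S: "subflow G X \<phi> S"
  shows "flow G (subtopology X S) (\<lambda>g. restrict (\<phi> g) S)"
proof -
  note D = flowD[OF F]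
  have SX: "S \<subseteq> topspace X" and inv: "\<And>g x. g \<in> carrier G \<Longrightarrow> x \<in> S \<Longrightarrow> \<phi> g x \<in> S"
    using S by (auto simp: subflow_def dest: closedin_subset)
  have top: "topspace (subtopology X S) = S"
    using SX by auto
  show ?thesis
  proof (rule flowI)
    show "compact_space (subtopology X S)"
      using S D(2) closedin_compact_space compact_space_subtopology by (auto simp: subflow_def)
    show "continuous_map (subtopology X S) (subtopology X S) (restrict (\<phi> g) S)"
      if "g \<in> carrier G" for g
      by (rule continuous_map_eq[where f = "\<phi> g"])
        (use that D(5) inv top in \<open>auto simp: continuous_map_in_subtopology
          continuous_map_from_subtopology\<close>)
  qed (use D inv SX top in \<open>auto simp: Hausdorff_space_subtopology subset_iff group.is_monoid
         monoid.m_closed monoid.one_closed\<close>)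
qed

lemma flow_enveloping_semigroup:
  assumes F: "flow G X \<phi>"
  shows "flow G (enveloping_topology G X \<phi>) (enveloping_action G X \<phi>)"
proof -
  note D = flowD[OF F]
  interpret group G by (rule D(1))
  define P where "P = product_topology (\<lambda>_. X) (topspace X)"
  define E where "E = enveloping_semigroup G X \<phi>"
  define L where "L g = (\<lambda>p\<in>topspace P. compose (topspace X) (\<phi> g) p)" for g
  have E: "E = P closure_of (\<phi> ` carrier G)"
    by (simp add: E_def P_def enveloping_semigroup_def)
  have topP: "topspace P = topspace X \<rightarrow>\<^sub>E topspace X"
    by (simp add: P_def)
  have maps: "\<phi> g x \<in> topspace X" if "g \<in> carrier G" "x \<in> topspace X" for g x
    using D(5) that by (auto simp: continuous_map_def)
  have \<phi>P: "\<phi> ` carrier G \<subseteq> topspace P"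
    using D(4) maps by (auto simp: topP PiE_def)
  have contL: "continuous_map P P (L g)" if g: "g \<in> carrier G" for g
    unfolding P_def continuous_map_componentwise
  proof (intro conjI ballI)
    show "L g ` topspace (product_topology (\<lambda>_. X) (topspace X)) \<subseteq> extensional (topspace X)"
      by (auto simp: L_def P_def)
    fix x assume x: "x \<in> topspace X"
    have "continuous_map P X (\<phi> g \<circ> (\<lambda>p. p x))"
      unfolding P_def
      by (rule continuous_map_compose[OF continuous_map_product_projection[OF x] D(5)[OF g]])
    then show "continuous_map (product_topology (\<lambda>_. X) (topspace X)) X (\<lambda>p. L g p x)"
      unfolding P_def
      by (rule continuous_map_eq) (use x in \<open>auto simp: L_def P_def compose_def\<close>)
  qed
  have flowP: "flow G P L"
  proof (rule flowI)
    show "compact_space P" "Hausdorff_space P"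
      using D(2,3) by (auto simp: P_def compact_space_product_topology Hausdorff_space_product_topology)
    show "L \<one>\<^bsub>G\<^esub> p = p" if "p \<in> topspace P" for p
      by (rule extensionalityI[where A="topspace X"])
        (use that D(6) in \<open>auto simp: L_def topP compose_def PiE_def Pi_def\<close>)
    show "L (g \<otimes>\<^bsub>G\<^esub> h) p = L g (L h p)"
      if "g \<in> carrier G" "h \<in> carrier G" "p \<in> topspace P" for g h p
    proof -
      have "compose (topspace X) (\<phi> h) p \<in> topspace P"
        using that maps by (auto simp: topP compose_def PiE_def Pi_def)
      then show ?thesis
        using that D(7)
        by (auto simp: L_def compose_def topP PiE_def Pi_def fun_eq_iff restrict_def)
    qed
  qed (use contL in \<open>auto simp: L_def group_axioms\<close>)
  have "L g ` E \<subseteq> E" if g: "g \<in> carrier G" for g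
  proof -
    have "L g (\<phi> h) = \<phi> (g \<otimes>\<^bsub>G\<^esub> h)" if "h \<in> carrier G" for h
      by (rule extensionalityI[where A="topspace X"])
        (use that g \<phi>P D(4,7) in \<open>auto simp: L_def compose_def\<close>)
    then have "L g ` \<phi> ` carrier G \<subseteq> \<phi> ` carrier G"
      using g by auto
    then show ?thesis
      unfolding E by (meson closure_of_mono contL g continuous_map_image_closure_subset order_trans)
  qed
  moreover have "\<phi> \<one>\<^bsub>G\<^esub> \<in> E"
    unfolding E using \<phi>P closure_of_subset by blast
  ultimately have "subflow G P L E"
    by (auto simp: subflow_def E)
  then have "flow G (subtopology P E) (\<lambda>g. restrict (L g) E)"
    using flowP by (rule flow_subflow[rotated])
  moreover have "restrict (L g) E = enveloping_action G X \<phi> g" for g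
    using closure_of_subset_topspace[of P]
    by (auto simp: L_def E E_def[symmetric] enveloping_action_def fun_eq_iff restrict_def subset_iff)
  ultimately show ?thesis
    by (simp add: enveloping_topology_def P_def E_def)
qed

end

theory Submission
  imports Defs "HOL-Number_Theory.Cong"
begin

text \<open>
  For points \<open>z\<^sub>0, z\<^sub>1\<close> of a flow \<open>X\<close>, evaluation \<open>p \<mapsto> (p z\<^sub>0, p z\<^sub>1)\<close> maps the enveloping semigroup
  equivariantly into the orbit closure of \<open>(z\<^sub>0, z\<^sub>1)\<close> in \<open>X \<times> X\<close>, and pushes invariant measures
  forward. So it is enough to find two minimal amenable flows, the orbit closures of \<open>z\<^sub>0\<close> and
  \<open>z\<^sub>1\<close>, such that the orbit closure of the pair carries no invariant measure; \<open>X\<close> is the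
  union of the two. The group is \<open>SL(2, \<int>)\<close>, written additively, and it acts by shifts on colourings
  \<open>G \<Rightarrow> [0, 1] \<times> \<complex>\<close>.

  The two colourings are Toeplitz colourings along finite-index subgroups \<open>N j\<close>. At stage \<open>j\<close> all
  positions of the translates \<open>n + F j\<close> (\<open>n \<in> N j\<close>) of a finite blob \<open>F j\<close> that are still blank are
  coloured: the first component records the stage as \<open>1 / (j + 1)\<close>; the second one is the direction
  \<open>(- f) \<cdot> 1\<close> at \<open>n + f\<close> in one of the colourings and the trivial symbol \<open>0\<close> in the other one, and the
  parity of \<open>j\<close> decides in which. A position of stage at most \<open>j\<close> keeps its colour along \<open>N j\<close>, hence
  each orbit closure is minimal (\<open>minimal_orbit_closure\<close>).

  The blobs are so sparse that in a random phase of the tower, a uniformly distributed coherent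
  choice of cosets of the \<open>N j\<close>, a position stays blank forever with probability at least \<open>1/2\<close>.
  Filling these holes with \<open>0\<close> gives an invariant measure, and it lives on the orbit closure of one
  colouring because arbitrarily large windows are filled with \<open>0\<close> at the stages of the right parity
  (\<open>pattern_in_orbit_closure\<close>, \<open>invariant_measure_orbit_closure\<close>).

  In the joint orbit closure this filling is impossible, since at every position exactly one of the
  two colourings shows a direction. If \<open>z\<close> is that direction at a hole \<open>h\<close>, then \<open>h \<cdot> z\<close> depends on
  the blob only. The blobs are nested so well that a finite window meets the boundary
  of at most one blob among those of large stage (\<open>blob_cut_once\<close>); therefore all the
  holes of a point of the joint orbit closure together show at most two such directions
  (\<open>two_directions\<close>). An invariant measure would thus produce an invariant random set of at most two
  directions that is nonempty with probability at least \<open>1/2\<close>. A shear in \<open>SL(2, \<int>)\<close> permutes infinitely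
  many disjoint sectors which cover all directions but the horizontal ones, so that the random set
  avoids each of them almost surely; and a quarter turn takes the horizontal directions to
  vertical ones. Hence the set is almost surely empty, a contradiction (\<open>no_invariant_joining\<close>).
\<close>

section \<open>Towers of sparse blobs in a residually finite group\<close>

definition window :: "nat \<Rightarrow> 'g::countable set" where
  "window j = from_nat ` {..j}"

lemma finite_window [simp]: "finite (window j)"
  by (simp add: window_def)

lemma window_mono: "i \<le> j \<Longrightarrow> window i \<subseteq> window j"
  by (auto simp: window_def)

lemma window_exhausts: "finite A \<Longrightarrow> \<exists>j. A \<subseteq> window j"
proof (induction rule: finite_induct)
  case (insert a A)
  then obtain j where "A \<subseteq> window j" by blast
  moreover have "a \<in> window (to_nat a)"
    unfolding window_def by (rule image_eqI[of _ _ "to_nat a"]) auto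
  ultimately have "insert a A \<subseteq> window (max j (to_nat a))"
    using window_mono[of j "max j (to_nat a)"] window_mono[of "to_nat a" "max j (to_nat a)"] by auto
  then show ?case ..
qed simp

locale finite_index_chain =
  fixes L :: "nat \<Rightarrow> 'g::{group_add, countable} set"
  assumes zero_mem [simp]: "0 \<in> L j"
    and diff_mem: "x \<in> L j \<Longrightarrow> y \<in> L j \<Longrightarrow> x - y \<in> L j"
    and Suc_subset: "L (Suc j) \<subseteq> L j"
    and finite_index: "\<exists>R. finite R \<and> (\<forall>g. \<exists>r\<in>R. g - r \<in> L j)"
begin

lemma minus_mem: "x \<in> L j \<Longrightarrow> - x \<in> L j"
  using diff_mem[of 0 j x] by simp

lemma add_mem: "x \<in> L j \<Longrightarrow> y \<in> L j \<Longrightarrow> x + y \<in> L j"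
  using diff_mem[of x j "- y"] minus_mem by simp

lemma antimono: "i \<le> j \<Longrightarrow> L j \<subseteq> L i"
  by (induction rule: dec_induct) (use Suc_subset in auto)

lemma coset_sym: "x - y \<in> L j \<Longrightarrow> y - x \<in> L j"
  using minus_mem[of "x - y" j] by simp

lemma coset_trans: "x - y \<in> L j \<Longrightarrow> y - z \<in> L j \<Longrightarrow> x - z \<in> L j"
  using add_mem[of "x - y" j "y - z"] by (simp add: diff_conv_add_uminus add.assoc del: add_uminus_conv_diff)

end

locale residual_chain = finite_index_chain L for L :: "nat \<Rightarrow> 'g::{group_add, countable} set" +
  assumes separating: "g \<noteq> 0 \<Longrightarrow> \<exists>j. g \<notin> L j"
    and infinite_group: "infinite (UNIV :: 'g set)"
begin

lemma avoid_finite: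
  assumes "finite Q"
  shows "\<exists>k. \<forall>j\<ge>k. L j \<inter> Q \<subseteq> {0}"
  using assms
proof (induction rule: finite_induct)
  case (insert q Q)
  then obtain k where k: "\<forall>j\<ge>k. L j \<inter> Q \<subseteq> {0}" by blast
  show ?case
  proof (cases "q = 0")
    case False
    then obtain l where "q \<notin> L l" using separating by blast
    then have "\<forall>j\<ge>max k l. L j \<inter> insert q Q \<subseteq> {0}"
      using k antimono by fastforce
    then show ?thesis ..
  qed (use k in auto)
qed simp

end

text \<open>Only finitely many elements are in conflict with those already chosen, so a greedy choice works.\<close>
lemma infinite_group_spread_set:
  fixes Q :: "'g::group_add set"
  assumes "infinite (UNIV :: 'g set)" "finite Q"
  shows "\<exists>C. finite C \<and> card C = n \<and> (\<forall>c\<in>C. \<forall>c'\<in>C. c \<noteq> c' \<longrightarrow> - c + c' \<notin> Q)"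
proof (induction n)
  case (Suc n)
  then obtain C where C: "finite C" "card C = n" "\<forall>c\<in>C. \<forall>c'\<in>C. c \<noteq> c' \<longrightarrow> - c + c' \<notin> Q"
    by blast
  define A where "A = C \<union> (\<lambda>(c, q). c + q) ` (C \<times> Q) \<union> (\<lambda>(c, q). c - q) ` (C \<times> Q)"
  have "finite A" using C assms by (simp add: A_def)
  then obtain d where d: "d \<notin> A" using assms(1) ex_new_if_finite by blast
  have 1: "- c + d \<notin> Q" if "c \<in> C" for c
  proof
    assume "- c + d \<in> Q"
    then have "c + (- c + d) \<in> A" using that by (force simp: A_def)
    then show False using d by simp
  qed
  have 2: "- d + c \<notin> Q" if "c \<in> C" for c
  proof
    assume "- d + c \<in> Q"
    then have "c - (- d + c) \<in> A" using that by (force simp: A_def)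
    then show False using d by (simp add: diff_conv_add_uminus minus_add del: add_uminus_conv_diff)
  qed
  have "d \<notin> C" using d by (auto simp: A_def)
  then have "finite (insert d C) \<and> card (insert d C) = Suc n \<and>
      (\<forall>c\<in>insert d C. \<forall>c'\<in>insert d C. c \<noteq> c' \<longrightarrow> - c + c' \<notin> Q)"
    using C 1 2 by auto
  then show ?case by blast
qed (auto intro: exI[of _ "{}"])

text \<open>The hypothesis under which a set is never cut by a blob of an earlier stage: every translate
  \<open>n + B i\<close> with \<open>i < j\<close> and \<open>n \<in> N i\<close> that meets the set lies inside it.\<close>
definition saturated :: "(nat \<Rightarrow> 'g::group_add set) \<Rightarrow> (nat \<Rightarrow> 'g set) \<Rightarrow> nat \<Rightarrow> 'g set \<Rightarrow> bool" where
  "saturated N B j S \<longleftrightarrow>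
     (\<forall>i<j. \<forall>n\<in>N i. \<forall>x\<in>B i. n + x \<in> S \<longrightarrow> (\<forall>y\<in>B i. n + y \<in> S))"

text \<open>Adding all level-\<open>j\<close> translates that meet the hull for the lower levels is enough: these
  translates are themselves saturated for the lower levels and pairwise disjoint, so the union stays
  saturated and the process does not propagate. This is where finiteness comes from, and where the
  disjointness of translates is needed for the enlarged blobs \<open>B\<close> and not only for \<open>F\<close>.\<close>
lemma saturated_hull:
  fixes N B :: "nat \<Rightarrow> 'g::group_add set"
  assumes sub: "\<And>i x y. i < j \<Longrightarrow> x \<in> N i \<Longrightarrow> y \<in> N i \<Longrightarrow> - x + y \<in> N i"
    and dec: "\<And>i i'. i' \<le> i \<Longrightarrow> i < j \<Longrightarrow> N i \<subseteq> N i'"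
    and fin: "\<And>i. i < j \<Longrightarrow> finite (B i)"
    and sat: "\<And>i. i < j \<Longrightarrow> saturated N B i (B i)"
    and disj: "\<And>i x y. i < j \<Longrightarrow> x \<in> B i \<Longrightarrow> y \<in> B i \<Longrightarrow> x - y \<in> N i \<Longrightarrow> x = y"
    and "finite S"
  shows "\<exists>T. finite T \<and> S \<subseteq> T \<and> saturated N B j T"
  using assms
proof (induction j)
  case 0
  then show ?case by (auto simp: saturated_def)
next
  case (Suc j)
  obtain T where T: "finite T" "S \<subseteq> T" "saturated N B j T"
  proof -
    have "\<exists>T. finite T \<and> S \<subseteq> T \<and> saturated N B j T"
    proof (rule Suc.IH)
      show "x = y" if "i < j" "x \<in> B i" "y \<in> B i" "x - y \<in> N i" for i x y
        using Suc.prems(5)[of i x y] that by simp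
    qed (use Suc.prems(1-4,6) in auto)
    then show ?thesis using that by blast
  qed
  define I where "I = {n \<in> N j. \<exists>x\<in>B j. n + x \<in> T}"
  have finB: "finite (B j)" using Suc.prems(3) by simp
  have "I \<subseteq> (\<lambda>(t, x). t - x) ` (T \<times> B j)"
  proof
    fix n assume "n \<in> I"
    then obtain x where "x \<in> B j" "n + x \<in> T" by (auto simp: I_def)
    then show "n \<in> (\<lambda>(t, x). t - x) ` (T \<times> B j)"
      by (intro image_eqI[of _ _ "(n + x, x)"]) auto
  qed
  then have "finite I" using T(1) finB by (meson finite_SigmaI finite_imageI finite_subset)
  define U where "U = T \<union> (\<Union>n\<in>I. (+) n ` B j)"
  have "finite U" using T(1) \<open>finite I\<close> finB by (simp add: U_def)
  moreover have "S \<subseteq> U" using T(2) by (auto simp: U_def)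
  moreover have "saturated N B (Suc j) U"
    unfolding saturated_def
  proof (intro allI impI ballI)
    fix i n x y
    assume i: "i < Suc j" and n: "n \<in> N i" and x: "x \<in> B i" and y: "y \<in> B i" and nx: "n + x \<in> U"
    show "n + y \<in> U"
    proof (cases "n + x \<in> T")
      case True
      show ?thesis
      proof (cases "i = j")
        case True
        then have "n \<in> I" using n x \<open>n + x \<in> T\<close> by (auto simp: I_def)
        then show ?thesis using y True by (auto simp: U_def)
      next
        case False
        then have "i < j" using i by simp
        then have "n + y \<in> T" using T(3) n x y True unfolding saturated_def by blast
        then show ?thesis by (simp add: U_def)
      qed
    next
      case False
      then obtain m z where m: "m \<in> I" "z \<in> B j" "n + x = m + z"
        using nx by (auto simp: U_def)
      then have mN: "m \<in> N j" by (simp add: I_def)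
      show ?thesis
      proof (cases "i = j")
        case True
        have "z = - m + (n + x)"
          using m(3) by simp
        then have "z - x = - m + n"
          by (simp add: diff_conv_add_uminus add.assoc del: add_uminus_conv_diff)
        then have "z - x \<in> N j" using Suc.prems(1)[of j m n] mN n True by simp
        then have "z = x" using Suc.prems(5)[of j z x] m x True by simp
        then have "m = n" using m by simp
        then show ?thesis using m y True by (auto simp: U_def)
      next
        case False
        then have "i < j" using i by simp
        then have "m \<in> N i" using Suc.prems(2)[of i j] mN by auto
        then have "- m + n \<in> N i" using Suc.prems(1)[of i m n] n i by simp
        moreover have "(- m + n) + x \<in> B j" using m by (simp add: add.assoc)
        ultimately have "(- m + n) + y \<in> B j"
          using Suc.prems(4)[of j] \<open>i < j\<close> x y by (auto simp: saturated_def)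
        then have "m + ((- m + n) + y) \<in> U" using m by (auto simp: U_def)
        then show ?thesis by (simp add: add.assoc)
      qed
    qed
  qed
  ultimately show ?case by blast
qed

text \<open>The blob \<open>F j\<close> is coloured at stage \<open>j\<close>; \<open>B j\<close> is a thickening of it by the window of size \<open>j\<close>.
  Thus if a window meets a translate of \<open>F j\<close>, it lies in the corresponding translate of \<open>B j\<close>, which
  no later blob cuts. The assumption \<open>transversal\<close> makes every phase modulo \<open>N j\<close> visible on a whole
  window inside \<open>F (Suc j)\<close>, and \<open>sparse\<close> provides \<open>2 ^ (j + 2)\<close> disjoint copies of \<open>N j + F j\<close>, so that
  stage \<open>j\<close> has density at most \<open>1 / 2 ^ (j + 2)\<close> and all the stages together at most \<open>1/2\<close>.\<close>
locale blob_tower = finite_index_chain N for N :: "nat \<Rightarrow> 'g::{group_add, countable} set" +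
  fixes F B :: "nat \<Rightarrow> 'g set"
  assumes finite_F: "finite (F j)"
    and F_subset_B: "F j \<subseteq> B j"
    and margin: "f \<in> F j \<Longrightarrow> w \<in> window j \<Longrightarrow> w' \<in> window j \<Longrightarrow> f - w + w' \<in> B j"
    and window_subset_F: "window j \<subseteq> F j"
    and transversal: "\<exists>r. g - r \<in> N j \<and> (\<forall>w\<in>window (Suc j). r + w \<in> F (Suc j))"
    and translates_disjoint: "x \<in> B j \<Longrightarrow> y \<in> B j \<Longrightarrow> x - y \<in> N j \<Longrightarrow> x = y"
    and nested: "saturated N B j (F j)"
    and sparse: "\<exists>C. finite C \<and> card C = 2 ^ (j + 2) \<and>
      (\<forall>c\<in>C. \<forall>c'\<in>C. \<forall>f\<in>F j. \<forall>f'\<in>F j. (f - c) - (f' - c') \<in> N j \<longrightarrow> c = c')"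

context residual_chain
begin

text \<open>The condition on the stage-\<open>j\<close> data \<open>(k, F, B)\<close>, where \<open>N j = L k\<close>, relative to the data \<open>\<tau>\<close> of the earlier stages.\<close>
definition tower_step ::
  "(nat \<Rightarrow> nat \<times> 'g set \<times> 'g set) \<Rightarrow> nat \<Rightarrow> nat \<times> 'g set \<times> 'g set \<Rightarrow> bool" where
  "tower_step \<tau> j t \<longleftrightarrow> (case t of (k, F, B) \<Rightarrow>
     (\<forall>i<j. fst (\<tau> i) \<le> k) \<and> finite F \<and> finite B \<and> F \<subseteq> B \<and>
     (\<forall>f\<in>F. \<forall>w\<in>window j. \<forall>w'\<in>window j. f - w + w' \<in> B) \<and>
     window j \<subseteq> F \<and>
     (\<forall>i g. j = Suc i \<longrightarrow> (\<exists>r. g - r \<in> L (fst (\<tau> i)) \<and> (\<forall>w\<in>window j. r + w \<in> F))) \<and>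
     (\<forall>x\<in>B. \<forall>y\<in>B. x - y \<in> L k \<longrightarrow> x = y) \<and>
     saturated (\<lambda>i. L (fst (\<tau> i))) (\<lambda>i. snd (snd (\<tau> i))) j F \<and>
     saturated (\<lambda>i. L (fst (\<tau> i))) (\<lambda>i. snd (snd (\<tau> i))) j B \<and>
     (\<exists>C. finite C \<and> card C = 2 ^ (j + 2) \<and>
        (\<forall>c\<in>C. \<forall>c'\<in>C. \<forall>f\<in>F. \<forall>f'\<in>F. (f - c) - (f' - c') \<in> L k \<longrightarrow> c = c')))"

text \<open>The blobs are chosen before the subgroup: every condition that involves \<open>L k\<close> says that \<open>L k\<close>
  avoids a finite set of nonzero elements, which holds for all large \<open>k\<close>.\<close>
lemma tower_step_exists:
  assumes prev: "\<And>i. i < j \<Longrightarrow> tower_step \<tau> i (\<tau> i)"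
  shows "\<exists>t. tower_step \<tau> j t"
proof -
  define N where "N i = L (fst (\<tau> i))" for i
  define B where "B i = snd (snd (\<tau> i))" for i
  note step = prev[unfolded tower_step_def case_prod_beta, folded N_def B_def]
  have N_mono: "N i \<subseteq> N i'" if "i' \<le> i" "i < j" for i i'
  proof -
    have "\<forall>i'<i. fst (\<tau> i') \<le> fst (\<tau> i)" using step[OF that(2)] by (elim conjE)
    then show ?thesis unfolding N_def using that(1) by (cases "i' = i") (auto intro!: antimono)
  qed
  have B_disjoint: "x = y" if "i < j" "x \<in> B i" "y \<in> B i" "x - y \<in> N i" for i x y
  proof -
    have "\<forall>x\<in>B i. \<forall>y\<in>B i. x - y \<in> N i \<longrightarrow> x = y" using step[OF that(1)] by (elim conjE)
    then show ?thesis using that by blast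
  qed
  have hull: "\<exists>T. finite T \<and> S \<subseteq> T \<and> saturated N B j T" if S: "finite S" for S
  proof (rule saturated_hull[OF _ _ _ _ _ S])
    show "- x + y \<in> N i" if "i < j" "x \<in> N i" "y \<in> N i" for i x y
      using that minus_mem add_mem unfolding N_def by blast
    show "finite (B i)" if "i < j" for i using step[OF that] by (elim conjE)
    show "saturated N B i (B i)" if "i < j" for i using step[OF that] by (elim conjE)
  qed (fact N_mono B_disjoint)+
  obtain R where R: "finite R" "\<forall>g. \<exists>r\<in>R. g - r \<in> N (j - 1)"
    using finite_index unfolding N_def by blast
  obtain F where F: "finite F" "(\<lambda>(r, w). r + w) ` (R \<times> window j) \<union> window j \<subseteq> F" "saturated N B j F"
    using hull[of "(\<lambda>(r, w). r + w) ` (R \<times> window j) \<union> window j"] R(1) by auto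
  obtain D where D: "finite D" "F \<union> (\<lambda>(f, w, w'). f - w + w') ` (F \<times> window j \<times> window j) \<subseteq> D"
      "saturated N B j D"
    using hull[of "F \<union> (\<lambda>(f, w, w'). f - w + w') ` (F \<times> window j \<times> window j)"] F(1) by auto
  define Q where "Q = (\<lambda>(f, f'). - f + f') ` (F \<times> F)"
  have "finite Q" using F(1) by (simp add: Q_def)
  then obtain C where C: "finite C" "card C = 2 ^ (j + 2)"
      "\<forall>c\<in>C. \<forall>c'\<in>C. c \<noteq> c' \<longrightarrow> - c + c' \<notin> Q"
    using infinite_group_spread_set[OF infinite_group, of Q "2 ^ (j + 2)"] by blast
  define V where "V = (\<lambda>(x, y). x - y) ` (D \<times> D) \<union>
      (\<lambda>(f, c, f', c'). (f - c) - (f' - c')) ` (F \<times> C \<times> F \<times> C)"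
  have "finite V" using D(1) F(1) C(1) by (simp add: V_def)
  then obtain k0 where k0: "\<forall>k\<ge>k0. L k \<inter> V \<subseteq> {0}" using avoid_finite by blast
  define k where "k = max k0 (Max (insert 0 ((\<lambda>i. fst (\<tau> i)) ` {..<j})))"
  have k: "fst (\<tau> i) \<le> k" if "i < j" for i
    using that by (auto simp: k_def intro!: max.coboundedI2 Max_ge)
  have LV: "v = 0" if "v \<in> L k" "v \<in> V" for v
  proof -
    have "k0 \<le> k" by (simp add: k_def)
    then show ?thesis using k0 that by blast
  qed
  have disj: "x = y" if "x \<in> D" "y \<in> D" "x - y \<in> L k" for x y
  proof -
    have "x - y \<in> V" unfolding V_def
      using that by (intro UnI1 image_eqI[of _ _ "(x, y)"]) auto
    with LV[OF that(3)] have "x - y = 0" by simp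
    then show ?thesis by simp
  qed
  have spread: "c = c'"
    if c: "c \<in> C" "c' \<in> C" "f \<in> F" "f' \<in> F" "(f - c) - (f' - c') \<in> L k" for c c' f f'
  proof (rule ccontr)
    assume "c \<noteq> c'"
    have "(f - c) - (f' - c') \<in> V" unfolding V_def
      using c by (intro UnI2 image_eqI[of _ _ "(f, c, f', c')"]) auto
    then have "(f - c) - (f' - c') = 0" using LV c by blast
    then have "f - c = f' - c'" by simp
    then have "- f + (f - c) + c' = - f + (f' - c') + c'" by simp
    then have "- c + c' = - f + f'"
      by (simp add: diff_conv_add_uminus add.assoc del: add_uminus_conv_diff)
    then have "- c + c' \<in> Q" using c unfolding Q_def
      by (intro image_eqI[of _ _ "(f, f')"]) auto
    then show False using C(3) c \<open>c \<noteq> c'\<close> by blast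
  qed
  have "tower_step \<tau> j (k, F, D)"
    unfolding tower_step_def prod.case N_def[symmetric] B_def[symmetric]
  proof (intro conjI)
    show "\<forall>i g. j = Suc i \<longrightarrow> (\<exists>r. g - r \<in> N i \<and> (\<forall>w\<in>window j. r + w \<in> F))"
    proof (intro allI impI)
      fix i g assume "j = Suc i"
      then obtain r where "r \<in> R" "g - r \<in> N i" using R(2) by auto
      then show "\<exists>r. g - r \<in> N i \<and> (\<forall>w\<in>window j. r + w \<in> F)" using F(2) by force
    qed
    show "\<forall>f\<in>F. \<forall>w\<in>window j. \<forall>w'\<in>window j. f - w + w' \<in> D"
      using D(2) by force
    show "\<exists>C. finite C \<and> card C = 2 ^ (j + 2) \<and>
        (\<forall>c\<in>C. \<forall>c'\<in>C. \<forall>f\<in>F. \<forall>f'\<in>F. (f - c) - (f' - c') \<in> L k \<longrightarrow> c = c')"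
      using C spread by blast
  qed (use k F D disj in auto)
  then show ?thesis by blast
qed

theorem blob_tower_exists: "\<exists>(N :: nat \<Rightarrow> 'g set) F B. blob_tower N F B"
proof -
  have "\<exists>\<tau>. \<forall>j. tower_step \<tau> j (\<tau> j)"
  proof (rule dependent_wellorder_choice)
    fix t and \<tau> \<tau>' :: "nat \<Rightarrow> nat \<times> 'g set \<times> 'g set" and j :: nat
    assume eq: "\<And>i. i < j \<Longrightarrow> \<tau> i = \<tau>' i"
    have sat: "saturated (\<lambda>i. L (fst (\<tau> i))) (\<lambda>i. snd (snd (\<tau> i))) j S
        = saturated (\<lambda>i. L (fst (\<tau>' i))) (\<lambda>i. snd (snd (\<tau>' i))) j S" for S
      using eq by (auto simp: saturated_def)
    show "tower_step \<tau> j t = tower_step \<tau>' j t"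
      unfolding tower_step_def sat using eq by (auto split: prod.splits)
  qed (use tower_step_exists in blast)
  then obtain \<tau> where \<tau>: "\<And>j. tower_step \<tau> j (\<tau> j)" by blast
  define N F B where "N j = L (fst (\<tau> j))" and "F j = fst (snd (\<tau> j))" and "B j = snd (snd (\<tau> j))" for j
  note step = \<tau>[unfolded tower_step_def case_prod_beta, folded N_def F_def B_def]
  have "blob_tower N F B"
  proof
    show "N (Suc j) \<subseteq> N j" for j
      unfolding N_def using step[of "Suc j"] by (intro antimono) auto
    show "x - y \<in> N j" if "x \<in> N j" "y \<in> N j" for x y j
      using that diff_mem by (simp add: N_def)
    show "\<exists>R. finite R \<and> (\<forall>g. \<exists>r\<in>R. g - r \<in> N j)" for j
      unfolding N_def by (rule finite_index)
    show "\<exists>r. g - r \<in> N j \<and> (\<forall>w\<in>window (Suc j). r + w \<in> F (Suc j))" for g j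
    proof -
      have "\<forall>i g. Suc j = Suc i \<longrightarrow>
          (\<exists>r. g - r \<in> N i \<and> (\<forall>w\<in>window (Suc j). r + w \<in> F (Suc j)))"
        using step[of "Suc j"] by (elim conjE)
      then show ?thesis by simp
    qed
    show "saturated N B j (F j)" for j
      using step[of j] unfolding N_def[abs_def] B_def[abs_def] by (elim conjE)
    show "x = y" if "x \<in> B j" "y \<in> B j" "x - y \<in> N j" for x y j
    proof -
      have "\<forall>x\<in>B j. \<forall>y\<in>B j. x - y \<in> N j \<longrightarrow> x = y"
        using step[of j] by (elim conjE)
      then show ?thesis using that by blast
    qed
    show "f - w + w' \<in> B j" if "f \<in> F j" "w \<in> window j" "w' \<in> window j" for f w w' j
    proof -
      have "\<forall>f\<in>F j. \<forall>w\<in>window j. \<forall>w'\<in>window j. f - w + w' \<in> B j"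
        using step[of j] by (elim conjE)
      then show ?thesis using that by blast
    qed
    show "finite (F j)" for j using step[of j] by (elim conjE)
    show "F j \<subseteq> B j" for j using step[of j] by (elim conjE)
    show "window j \<subseteq> F j" for j using step[of j] by (elim conjE)
    show "\<exists>C. finite C \<and> card C = 2 ^ (j + 2) \<and>
        (\<forall>c\<in>C. \<forall>c'\<in>C. \<forall>f\<in>F j. \<forall>f'\<in>F j. (f - c) - (f' - c') \<in> N j \<longrightarrow> c = c')" for j
      using step[of j] by (elim conjE)
    show "0 \<in> N j" for j by (simp add: N_def)
  qed
  then show ?thesis by blast
qed

end

section \<open>Realizing a continuous action as a flow on real sequences\<close>

text \<open>The Borel sets of a subspace in the sense of \<open>regular_borel_probability\<close> are the traces of Borel sets.\<close>
lemma sets_restrict_borel: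
  fixes S :: "'a::topological_space set"
  assumes "S \<in> sets borel"
  shows "sets (restrict_space borel S) = sets (sigma S {U. openin (top_of_set S) U})"
proof -
  have "(\<inter>) S ` sigma_sets UNIV {U. open U} = sigma_sets S ((\<inter>) S ` {U. open U})"
    by (rule sigma_sets_Int) (use assms in \<open>auto simp: borel_def\<close>)
  also have "(\<inter>) S ` {U. open U} = {U. openin (top_of_set S) U}"
    by (auto simp: openin_open)
  also have "(\<inter>) S ` sigma_sets UNIV {U. open U} = sets (restrict_space borel S)"
    by (simp add: sets_restrict_space borel_def)
  finally show ?thesis
    by (subst sets_measure_of) (use openin_imp_subset in blast, simp)
qed

lemma regular_borel_probability_restrict:
  fixes M :: "'a::{second_countable_topology, complete_space} measure"
  assumes "prob_space M" "sets M = sets borel" "closed S" "emeasure M S = 1"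
  shows "regular_borel_probability (top_of_set S) (restrict_space M S)"
proof -
  interpret prob_space M by fact
  have S: "S \<in> sets borel" using assms by auto
  have SM: "S \<inter> space M \<in> sets M" using assms S by auto
  have sets: "sets (restrict_space M S) = sets (sigma S {U. openin (top_of_set S) U})"
    using sets_restrict_borel[OF S] sets_restrict_space_cong[OF assms(2)] by simp
  have em: "emeasure (restrict_space M S) A = emeasure M A" if "A \<subseteq> S" for A
    by (rule emeasure_restrict_space[OF SM that])
  have fin: "emeasure M (space M) \<noteq> \<infinity>" by simp
  have "emeasure (restrict_space M S) A
      = (SUP K\<in>{K. compactin (top_of_set S) K \<and> K \<subseteq> A}. emeasure (restrict_space M S) K)"
    "emeasure (restrict_space M S) A
      = (INF U\<in>{U. openin (top_of_set S) U \<and> A \<subseteq> U}. emeasure (restrict_space M S) U)"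
    if A: "A \<in> sets (restrict_space M S)" for A
  proof -
    have AS: "A \<subseteq> S" and AB: "A \<in> sets borel"
      using A S assms(2) sets_eq_imp_space_eq[OF assms(2)] by (auto simp: sets_restrict_space_iff[OF SM])
    have K: "{K. compactin (top_of_set S) K \<and> K \<subseteq> A} = {K. K \<subseteq> A \<and> compact K}"
      using AS by (auto simp: compactin_subtopology)
    have "emeasure M A = (SUP K\<in>{K. compactin (top_of_set S) K \<and> K \<subseteq> A}. emeasure M K)"
      unfolding K by (rule inner_regular[OF assms(2) fin AB])
    also have "\<dots> = (SUP K\<in>{K. compactin (top_of_set S) K \<and> K \<subseteq> A}. emeasure (restrict_space M S) K)"
      by (rule SUP_cong) (use AS em in auto)
    finally show "emeasure (restrict_space M S) A
      = (SUP K\<in>{K. compactin (top_of_set S) K \<and> K \<subseteq> A}. emeasure (restrict_space M S) K)"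
      using em[OF AS] by simp
    show "emeasure (restrict_space M S) A
      = (INF U\<in>{U. openin (top_of_set S) U \<and> A \<subseteq> U}. emeasure (restrict_space M S) U)"
    proof (rule antisym)
      show "emeasure (restrict_space M S) A
          \<le> (INF U\<in>{U. openin (top_of_set S) U \<and> A \<subseteq> U}. emeasure (restrict_space M S) U)"
      proof (rule INF_greatest)
        fix U assume "U \<in> {U. openin (top_of_set S) U \<and> A \<subseteq> U}"
        then show "emeasure (restrict_space M S) A \<le> emeasure (restrict_space M S) U"
          unfolding sets using openin_imp_subset
          by (intro emeasure_mono) (auto simp: sets intro!: in_measure_of)
      qed
      have "(INF U\<in>{U. openin (top_of_set S) U \<and> A \<subseteq> U}. emeasure (restrict_space M S) U)
          \<le> (INF U\<in>{U. A \<subseteq> U \<and> open U}. emeasure M U)"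
      proof (rule INF_mono)
        fix U assume U: "U \<in> {U. A \<subseteq> U \<and> open U}"
        then have "emeasure (restrict_space M S) (S \<inter> U) \<le> emeasure M U"
          using assms(2) by (subst em) (auto intro!: emeasure_mono)
        then show "\<exists>V\<in>{V. openin (top_of_set S) V \<and> A \<subseteq> V}. emeasure (restrict_space M S) V \<le> emeasure M U"
          using U AS by (intro bexI[of _ "S \<inter> U"]) (auto simp: openin_open)
      qed
      also have "\<dots> = emeasure M A" by (rule outer_regular[OF assms(2) fin AB, symmetric])
      finally show "(INF U\<in>{U. openin (top_of_set S) U \<and> A \<subseteq> U}. emeasure (restrict_space M S) U)
          \<le> emeasure (restrict_space M S) A" using em[OF AS] by simp
    qed
  qed
  moreover have "prob_space (restrict_space M S)"
    by (rule prob_space_restrict_space) (use assms S in auto)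
  ultimately show ?thesis using sets by (simp add: regular_borel_probability_def)
qed

text \<open>A countable group acting on a compact set \<open>S\<close> is turned into a flow on a set of real sequences with a
  group of real numbers: \<open>e\<close> embeds the points and \<open>to_nat\<close> the group elements.\<close>
locale embedded_action =
  fixes act :: "'g::{group_add, countable} \<Rightarrow> 'x::{second_countable_topology, t2_space} \<Rightarrow> 'x"
    and e :: "'x \<Rightarrow> nat \<Rightarrow> real" and S :: "'x set"
  assumes act_zero: "act 0 x = x"
    and act_add: "act (g + h) x = act g (act h x)"
    and continuous_act: "continuous_on UNIV (act g)"
    and continuous_e: "continuous_on UNIV e"
    and inj_e: "inj e"
    and compact_S: "compact S"
    and invariant_S: "x \<in> S \<Longrightarrow> act g x \<in> S"
begin

definition code :: "'g \<Rightarrow> real" where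
  "code g = real (to_nat g)"

definition decode :: "real \<Rightarrow> 'g" where
  "decode = inv_into UNIV code"

definition unembed :: "(nat \<Rightarrow> real) \<Rightarrow> 'x" where
  "unembed = inv_into UNIV e"

definition coded_group :: "real monoid" where
  "coded_group = \<lparr>carrier = range code, monoid.mult = (\<lambda>a b. code (decode a + decode b)), one = code 0\<rparr>"

definition coded_space :: "(nat \<Rightarrow> real) topology" where
  "coded_space = top_of_set (e ` S)"

definition coded_action :: "real \<Rightarrow> (nat \<Rightarrow> real) \<Rightarrow> (nat \<Rightarrow> real)" where
  "coded_action r = (\<lambda>x\<in>e ` S. e (act (decode r) (unembed x)))"

lemma inj_code: "inj code"
  by (auto simp: inj_def code_def)

lemma decode_code [simp]: "decode (code g) = g"
  by (simp add: decode_def inj_code)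

lemma unembed_e [simp]: "unembed (e x) = x"
  by (simp add: unembed_def inj_e)

lemma carrier_coded_group [simp]: "carrier coded_group = range code"
  by (simp add: coded_group_def)

lemma coded_group_ops [simp]:
  "code g \<otimes>\<^bsub>coded_group\<^esub> code h = code (g + h)" "\<one>\<^bsub>coded_group\<^esub> = code 0"
  by (simp_all add: coded_group_def)

lemma group_coded_group: "group coded_group"
proof (rule groupI)
  show "\<exists>y\<in>carrier coded_group. y \<otimes>\<^bsub>coded_group\<^esub> x = \<one>\<^bsub>coded_group\<^esub>"
    if "x \<in> carrier coded_group" for x
  proof -
    from that obtain g where "x = code g" by auto
    then show ?thesis by (intro bexI[of _ "code (- g)"]) auto
  qed
qed (auto simp: add.assoc)

lemma inv_coded_group [simp]: "inv\<^bsub>coded_group\<^esub> (code g) = code (- g)"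
  by (rule group.inv_equality[OF group_coded_group]) auto

lemma topspace_coded [simp]: "topspace coded_space = e ` S"
  by (simp add: coded_space_def)

lemma coded_action_code [simp]: "x \<in> S \<Longrightarrow> coded_action (code g) (e x) = e (act g x)"
  by (simp add: coded_action_def)

lemma continuous_unembed: "continuous_on (e ` S) unembed"
  by (rule continuous_on_inv) (use continuous_e compact_S in \<open>auto intro: continuous_on_subset\<close>)

lemma flow_coded: "flow coded_group coded_space coded_action"
proof (rule flowI[OF group_coded_group])
  show "compact_space coded_space"
    unfolding coded_space_def
    by (intro compact_space_subtopology)
      (use compact_continuous_image[OF continuous_on_subset[OF continuous_e] compact_S] in simp)
  show "Hausdorff_space coded_space"
    unfolding coded_space_def by (intro Hausdorff_space_subtopology Hausdorff_space_euclidean)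
  show "continuous_map coded_space coded_space (coded_action r)" if r: "r \<in> carrier coded_group" for r
  proof -
    have "continuous_on (e ` S) (\<lambda>x. e (act (decode r) (unembed x)))"
      by (intro continuous_on_compose2[OF continuous_e] continuous_on_compose2[OF continuous_act]
          continuous_unembed) auto
    then have "continuous_on (e ` S) (coded_action r)"
      by (rule continuous_on_eq) (auto simp: coded_action_def)
    then show ?thesis
      unfolding coded_space_def by (auto simp: coded_action_def invariant_S)
  qed
qed (auto simp: coded_action_def act_zero act_add invariant_S)

lemma metrizable_coded: "metrizable_space coded_space"
  unfolding coded_space_def by (intro metrizable_space_subtopology metrizable_space_euclidean)

lemma hereditarily_amenable_coded:
  assumes inv_measure: "\<And>C. closed C \<Longrightarrow> C \<subseteq> S \<Longrightarrow> C \<noteq> {} \<Longrightarrow> (\<And>g x. x \<in> C \<Longrightarrow> act g x \<in> C) \<Longrightarrow>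
      \<exists>M. prob_space M \<and> sets M = sets borel \<and> emeasure M C = 1 \<and> (\<forall>g. distr M borel (act g) = M)"
  shows "hereditarily_amenable_flow coded_group coded_space coded_action"
  unfolding hereditarily_amenable_flow_def
proof (intro allI impI)
  fix T assume T: "subflow coded_group coded_space coded_action T"
  have closed_S: "closed (e ` S)"
    using compact_continuous_image[OF continuous_on_subset[OF continuous_e] compact_S]
    by (simp add: compact_imp_closed)
  have closed_T: "closed T" and TS: "T \<subseteq> e ` S"
    using T closed_S by (auto simp: subflow_def coded_space_def closedin_closed_eq)
  define C where "C = S \<inter> e -` T"
  have T_eq: "T = e ` C" using TS by (auto simp: C_def)
  have T_inv: "act g x \<in> C" if "x \<in> C" for g x
  proof -
    have "coded_action (code g) ` T \<subseteq> T" using T by (auto simp: subflow_def)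
    then have "coded_action (code g) (e x) \<in> T" using that by (auto simp: C_def image_subset_iff simp del: coded_action_code)
    then show ?thesis using that by (auto simp: C_def invariant_S)
  qed
  have "closed C"
    unfolding C_def using compact_S closed_T continuous_e
    by (intro closed_Int closed_vimage) (auto simp: compact_imp_closed)
  moreover have "C \<noteq> {}" using T T_eq by (auto simp: subflow_def)
  ultimately obtain M where M: "prob_space M" "sets M = sets borel" "emeasure M C = 1"
      and M_inv: "\<And>g. distr M borel (act g) = M"
    using inv_measure[of C] T_inv by (auto simp: C_def)
  interpret prob_space M by fact
  have e_meas [measurable]: "e \<in> borel_measurable borel"
    by (rule borel_measurable_continuous_onI[OF continuous_e])
  have act_meas [measurable]: "act g \<in> borel_measurable borel" for g
    by (rule borel_measurable_continuous_onI[OF continuous_act])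
  note M(2) [measurable_cong]
  have space_M: "space M = UNIV" using sets_eq_imp_space_eq[OF M(2)] by simp
  define M' where "M' = distr M borel e"
  have M': "prob_space M'" "sets M' = sets borel"
    unfolding M'_def by (auto intro: prob_space_distr)
  have TB: "T \<in> sets borel" using closed_T by auto
  have full: "emeasure M' T = 1"
  proof -
    have "emeasure M' T = emeasure M (e -` T)"
      unfolding M'_def using TB by (subst emeasure_distr) (auto simp: space_M)
    also have "\<dots> \<ge> emeasure M C"
      using TB M(2) measurable_sets[OF e_meas TB] by (intro emeasure_mono) (auto simp: C_def)
    finally show ?thesis using M(3) prob_space.emeasure_le_1[OF M(1)] prob_space.emeasure_le_1[OF M'(1)]
      by (metis antisym)
  qed
  have "amenable_flow coded_group (top_of_set T) (\<lambda>g. restrict (coded_action g) T)"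
    unfolding amenable_flow_def
  proof (intro exI conjI ballI)
    show "regular_borel_probability (top_of_set T) (restrict_space M' T)"
      by (rule regular_borel_probability_restrict[OF M' closed_T full])
    fix r A assume "r \<in> carrier coded_group" and A: "A \<in> sets (restrict_space M' T)"
    then obtain g where r: "r = code g" by auto
    have AT: "A \<subseteq> T" and AB: "A \<in> sets borel"
      using A M'(2) TB by (auto simp: sets_restrict_space)
    define Q where "Q = C \<inter> e -` A"
    have "C \<in> sets borel" using \<open>closed C\<close> by auto
    then have Q: "Q \<in> sets borel"
      unfolding Q_def using measurable_sets[OF e_meas AB] by auto
    have A_eq: "A = e ` Q" using AT T_eq by (auto simp: Q_def)
    have img: "restrict (coded_action r) T ` A = e ` (act g ` Q)"
    proof -
      have "restrict (coded_action r) T (e x) = e (act g x)" if "x \<in> Q" for x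
        using that AT by (auto simp: Q_def C_def r)
      then show ?thesis unfolding A_eq image_image by (rule image_cong[OF refl])
    qed
    have gQ: "act g ` Q = act (- g) -` Q"
    proof (intro equalityI subsetI)
      show "x \<in> act (- g) -` Q" if "x \<in> act g ` Q" for x
        using that by (auto simp: act_add[symmetric] act_zero)
      show "x \<in> act g ` Q" if "x \<in> act (- g) -` Q" for x
        using that by (intro image_eqI[of _ _ "act (- g) x"]) (auto simp: act_add[symmetric] act_zero)
    qed
    have gQB: "act g ` Q \<in> sets borel"
      unfolding gQ using measurable_sets[OF act_meas Q, of "- g"] by simp
    have gQC: "act g ` Q \<subseteq> C" using T_inv by (auto simp: Q_def)
    have em: "emeasure (restrict_space M' T) (e ` R) = emeasure M R"
      if R: "R \<in> sets borel" "R \<subseteq> C" and eR: "e ` R \<in> sets borel" for R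
    proof -
      have "e ` R \<subseteq> T" using R T_eq by auto
      then have "emeasure (restrict_space M' T) (e ` R) = emeasure M' (e ` R)"
        using TB M'(2) by (intro emeasure_restrict_space) auto
      also have "\<dots> = emeasure M (e -` e ` R)"
        unfolding M'_def using eR by (subst emeasure_distr) (auto simp: space_M)
      also have "e -` e ` R = R" using inj_e by (auto dest: injD)
      finally show ?thesis .
    qed
    have eimg: "e ` R \<in> sets borel" if R: "R \<in> sets borel" "R \<subseteq> C" for R
    proof -
      have "unembed \<in> borel_measurable (restrict_space borel (e ` S))"
        by (rule borel_measurable_continuous_on_restrict[OF continuous_unembed])
      then have "unembed -` R \<inter> space (restrict_space borel (e ` S)) \<in> sets (restrict_space borel (e ` S))"
        by (rule measurable_sets) (rule R)
      moreover have "unembed -` R \<inter> space (restrict_space borel (e ` S)) = e ` R"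
        using R(2) by (auto simp: space_restrict_space C_def)
      moreover have "e ` S \<in> sets borel" using closed_S by auto
      ultimately show ?thesis
        by (auto simp: sets_restrict_space)
    qed
    have QC: "Q \<subseteq> C" by (auto simp: Q_def)
    have "emeasure (restrict_space M' T) (restrict (coded_action r) T ` A) = emeasure M (act (- g) -` Q)"
      unfolding img using em[OF gQB gQC eimg[OF gQB gQC]] gQ by simp
    also have "\<dots> = emeasure (distr M borel (act (- g))) Q"
      using Q by (subst emeasure_distr) (auto simp: space_M)
    also have "\<dots> = emeasure M Q" by (simp add: M_inv)
    also have "\<dots> = emeasure (restrict_space M' T) A"
      using em[OF Q QC eimg[OF Q QC]] A_eq by simp
    finally show "emeasure (restrict_space M' T) (restrict (coded_action r) T ` A) = emeasure (restrict_space M' T) A" .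
  qed
  moreover have "subtopology coded_space T = top_of_set T"
    using TS by (simp add: coded_space_def subtopology_subtopology Int_absorb1)
  ultimately show "amenable_flow coded_group (subtopology coded_space T) (\<lambda>g. restrict (coded_action g) T)" by simp
qed

text \<open>Evaluation at \<open>e z1\<close> and \<open>e z2\<close> pushes an invariant measure on the enveloping semigroup forward
  to the orbit closure of \<open>(z1, z2)\<close>.\<close>
lemma not_amenable_enveloping:
  assumes z: "z1 \<in> S" "z2 \<in> S"
    and no_measure: "\<And>P :: ('x \<times> 'x) measure. prob_space P \<Longrightarrow> sets P = sets borel \<Longrightarrow>
      emeasure P (closure (range (\<lambda>g. (act g z1, act g z2)))) = 1 \<Longrightarrow>
      (\<And>g. distr P borel (\<lambda>(x, y). (act g x, act g y)) = P) \<Longrightarrow> False"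
  shows "\<not> amenable_flow coded_group (enveloping_topology coded_group coded_space coded_action) (enveloping_action coded_group coded_space coded_action)"
proof
  let ?ET = "enveloping_topology coded_group coded_space coded_action" and ?act = "enveloping_action coded_group coded_space coded_action"
  let ?P = "product_topology (\<lambda>_. coded_space) (topspace coded_space)" and ?E = "enveloping_semigroup coded_group coded_space coded_action"
  assume "amenable_flow coded_group ?ET ?act"
  then obtain M where M: "regular_borel_probability ?ET M"
    and M_inv: "\<And>g A. A \<in> sets M \<Longrightarrow> emeasure M (?act (code g) ` A) = emeasure M A"
    unfolding amenable_flow_def by auto
  note D = flowD[OF flow_enveloping_semigroup[OF flow_coded]]
  have sets_M: "sets M = sets (sigma (topspace ?ET) {U. openin ?ET U})" and "prob_space M"
    using M by (auto simp: regular_borel_probability_def)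
  interpret prob_space M by fact
  have sets_M': "sets M = sigma_sets (topspace ?ET) {U. openin ?ET U}"
    unfolding sets_M by (rule sets_measure_of) (auto dest: openin_subset)
  have space_M: "space M = topspace ?ET"
    using sets_eq_imp_space_eq[OF sets_M] by (simp add: space_measure_of_conv)
  define orbit where "orbit = range (\<lambda>g. (act g z1, act g z2))"
  define f where "f p = (unembed (p (e z1)), unembed (p (e z2)))" for p :: "(nat \<Rightarrow> real) \<Rightarrow> nat \<Rightarrow> real"
  have coord: "continuous_map ?P euclidean (\<lambda>p. unembed (p (e z)))" if "z \<in> S" for z
  proof -
    have "continuous_map ?P coded_space (\<lambda>p. p (e z))"
      by (rule continuous_map_product_projection) (use that in simp)
    moreover have "continuous_map coded_space euclidean unembed"
      unfolding coded_space_def using continuous_unembed by simp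
    ultimately have "continuous_map ?P euclidean (unembed \<circ> (\<lambda>p. p (e z)))"
      by (rule continuous_map_compose)
    then show ?thesis by (simp add: o_def)
  qed
  have f_cont: "continuous_map ?P euclidean f"
    unfolding f_def[abs_def] prod_topology_euclidean[symmetric] continuous_map_pairwise
    using coord[OF z(1)] coord[OF z(2)] by (simp add: o_def)
  have f_contE: "continuous_map ?ET euclidean f"
    unfolding enveloping_topology_def by (rule continuous_map_from_subtopology[OF f_cont])
  have topET: "topspace ?ET = ?E"
    unfolding enveloping_topology_def enveloping_semigroup_def
    by (auto simp: closure_of_subset_topspace Int_absorb1 simp del: topspace_product_topology)
  have f_in: "f p \<in> closure orbit" if "p \<in> topspace ?ET" for p
  proof -
    have "f ` (?P closure_of (coded_action ` carrier coded_group)) \<subseteq> euclidean closure_of (f ` coded_action ` carrier coded_group)"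
      by (rule continuous_map_image_closure_subset[OF f_cont])
    moreover have "f ` coded_action ` carrier coded_group = orbit"
      using z by (auto simp: f_def orbit_def image_image image_iff)
    ultimately show ?thesis using that by (auto simp: topET enveloping_semigroup_def)
  qed
  have f_act: "f (?act (code g) p) = (act g (fst (f p)), act g (snd (f p)))"
    if "p \<in> topspace ?ET" for g p
  proof -
    have "p \<in> topspace ?P"
      using that unfolding topET enveloping_semigroup_def
      by (rule subsetD[OF closure_of_subset_topspace])
    then have "p (e z) \<in> e ` S" if "z \<in> S" for z using that by auto
    then have "coded_action (code g) (p (e z)) = e (act g (unembed (p (e z))))" if "z \<in> S" for z
      using that by (auto simp: coded_action_def)
    then show ?thesis
      using that z by (auto simp: f_def enveloping_action_def compose_def topET)
  qed
  have f_meas [measurable]: "f \<in> borel_measurable M"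
  proof (rule borel_measurableI)
    fix U :: "('x \<times> 'x) set" assume "open U"
    then have "openin ?ET {p \<in> topspace ?ET. f p \<in> U}"
      using f_contE by (intro openin_continuous_map_preimage) auto
    then show "f -` U \<inter> space M \<in> sets M"
      unfolding sets_M' space_M by (intro sigma_sets.Basic) (auto simp: vimage_def Int_def conj_commute)
  qed
  define \<Lambda> where "\<Lambda> = distr M borel f"
  have "prob_space \<Lambda>" "sets \<Lambda> = sets borel"
    unfolding \<Lambda>_def by (auto intro: prob_space_distr)
  moreover have "emeasure \<Lambda> (closure orbit) = 1"
  proof -
    have "emeasure \<Lambda> (closure orbit) = emeasure M (f -` closure orbit \<inter> space M)"
      unfolding \<Lambda>_def by (rule emeasure_distr) auto
    also have "f -` closure orbit \<inter> space M = space M" using f_in by (auto simp: space_M)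
    finally show ?thesis using emeasure_space_1 by simp
  qed
  moreover have "distr \<Lambda> borel (\<lambda>(x, y). (act g x, act g y)) = \<Lambda>" for g
  proof (rule measure_eqI)
    have "continuous_on UNIV (\<lambda>(x, y). (act g x, act g y))"
      unfolding case_prod_beta
      by (intro continuous_on_Pair continuous_on_compose2[OF continuous_act] continuous_on_fst
          continuous_on_snd continuous_on_id) auto
    then have [measurable]: "(\<lambda>(x, y). (act g x, act g y)) \<in> borel_measurable borel"
      by (rule borel_measurable_continuous_onI)
    fix A assume "A \<in> sets (distr \<Lambda> borel (\<lambda>(x, y). (act g x, act g y)))"
    then have A: "A \<in> sets borel" by simp
    define Q where "Q = f -` A \<inter> space M"
    have "Q \<in> sets M" unfolding Q_def using measurable_sets[OF f_meas A] .
    have stays: "?act (code h) p \<in> topspace ?ET" if "p \<in> topspace ?ET" for p h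
      using D(5)[of "code h"] that by (auto simp: continuous_map_def)
    have undo: "?act (code (- h)) (?act (code h) p) = p" if "p \<in> topspace ?ET" for p h
      using D(7)[of "code (- h)" "code h" p] D(6)[of p] that by simp
    have "emeasure (distr \<Lambda> borel (\<lambda>(x, y). (act g x, act g y))) A
        = emeasure \<Lambda> ((\<lambda>(x, y). (act g x, act g y)) -` A)"
      using A by (subst emeasure_distr) (auto simp: \<Lambda>_def)
    also have "\<dots> = emeasure M (f -` ((\<lambda>(x, y). (act g x, act g y)) -` A) \<inter> space M)"
      unfolding \<Lambda>_def
      using measurable_sets[of "\<lambda>(x, y). (act g x, act g y)" borel borel A] A
      by (subst emeasure_distr) auto
    also have "f -` ((\<lambda>(x, y). (act g x, act g y)) -` A) \<inter> space M = ?act (code (- g)) ` Q"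
    proof (intro equalityI subsetI)
      fix p assume "p \<in> f -` ((\<lambda>(x, y). (act g x, act g y)) -` A) \<inter> space M"
      then have "p \<in> topspace ?ET" "f (?act (code g) p) \<in> A"
        using f_act[of p g] by (auto simp: space_M case_prod_beta)
      then show "p \<in> ?act (code (- g)) ` Q"
        using undo[of p g] stays[of p g] by (intro image_eqI[of _ _ "?act (code g) p"]) (auto simp: Q_def space_M)
    next
      fix p assume "p \<in> ?act (code (- g)) ` Q"
      then obtain q where q: "q \<in> topspace ?ET" "f q \<in> A" "p = ?act (code (- g)) q"
        by (auto simp: Q_def space_M)
      then have "p \<in> topspace ?ET" "?act (code g) p = q"
        using stays[of q "- g"] undo[of q "- g"] by auto
      then show "p \<in> f -` ((\<lambda>(x, y). (act g x, act g y)) -` A) \<inter> space M"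
        using f_act[of p g] q(2) by (auto simp: space_M case_prod_beta)
    qed
    also have "emeasure M (?act (code (- g)) ` Q) = emeasure M Q" by (rule M_inv) fact
    also have "\<dots> = emeasure \<Lambda> A"
      unfolding \<Lambda>_def Q_def using A by (subst emeasure_distr) auto
    finally show "emeasure (distr \<Lambda> borel (\<lambda>(x, y). (act g x, act g y))) A = emeasure \<Lambda> A" .
  qed (simp add: \<Lambda>_def)
  ultimately show False using no_measure[of \<Lambda>] by (simp add: orbit_def)
qed

end

section \<open>A random phase of a chain of finite-index subgroups\<close>

context finite_index_chain
begin

definition rep :: "nat \<Rightarrow> 'g \<Rightarrow> 'g" where
  "rep j x = (SOME r. x - r \<in> L j)"

lemma diff_rep: "x - rep j x \<in> L j"
  unfolding rep_def by (rule someI[of _ x]) simp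

lemma rep_eq_iff: "rep j x = rep j y \<longleftrightarrow> x - y \<in> L j"
proof
  assume "rep j x = rep j y"
  then show "x - y \<in> L j"
    using coset_trans[OF diff_rep[of x j], of y] coset_sym[OF diff_rep[of y j]] by simp
next
  assume "x - y \<in> L j"
  then have "(\<lambda>r. x - r \<in> L j) = (\<lambda>r. y - r \<in> L j)"
    using coset_trans coset_sym by (intro ext) blast
  then show "rep j x = rep j y" by (simp add: rep_def)
qed

lemma finite_range_rep: "finite (range (rep j))"
proof -
  obtain R where R: "finite R" "\<And>g. \<exists>r\<in>R. g - r \<in> L j" using finite_index by blast
  have "range (rep j) \<subseteq> rep j ` R"
  proof
    fix x assume "x \<in> range (rep j)"
    then obtain g where "x = rep j g" by blast
    then show "x \<in> rep j ` R" using R(2)[of g] by (auto simp: rep_eq_iff image_iff)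
  qed
  then show ?thesis using R(1) finite_subset by blast
qed

text \<open>The parent of \<open>L j\<close> in the chain \<open>UNIV, L 0, L 1, \<dots>\<close>. The random phase is a random walk down this
  chain: a uniformly distributed digit from a transversal of \<open>L j\<close> in \<open>parent j\<close> refines
  a coset of \<open>parent j\<close> to a coset of \<open>L j\<close>.\<close>
definition parent :: "nat \<Rightarrow> 'g set" where
  "parent j = (if j = 0 then UNIV else L (j - 1))"

lemma parent_Suc [simp]: "parent (Suc j) = L j"
  by (simp add: parent_def)

lemma subset_parent: "L j \<subseteq> parent j"
  by (cases j) (use Suc_subset in \<open>auto simp: parent_def\<close>)

lemma parent_add: "x \<in> parent j \<Longrightarrow> y \<in> parent j \<Longrightarrow> x + y \<in> parent j"
  using add_mem by (auto simp: parent_def)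

lemma parent_minus: "x \<in> parent j \<Longrightarrow> - x \<in> parent j"
  using minus_mem by (auto simp: parent_def)

definition digits :: "nat \<Rightarrow> 'g set" where
  "digits j = rep j ` parent j"

lemma finite_digits: "finite (digits j)"
  using finite_range_rep by (rule finite_subset[rotated]) (auto simp: digits_def)

lemma digits_nonempty: "digits j \<noteq> {}"
  by (auto simp: digits_def parent_def intro: zero_mem)

lemma digits_subset: "digits j \<subseteq> parent j"
proof
  fix r assume "r \<in> digits j"
  then obtain x where x: "x \<in> parent j" "r = rep j x" by (auto simp: digits_def)
  have "x - r \<in> parent j" using diff_rep[of x j] subset_parent x by auto
  then have "- (x - r) + x \<in> parent j" using x by (intro parent_add parent_minus)
  then show "r \<in> parent j" by (simp add: diff_conv_add_uminus minus_add add.assoc del: add_uminus_conv_diff)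
qed

lemma unique_digit:
  assumes "x \<in> parent j"
  shows "rep j x \<in> digits j" and "r \<in> digits j \<Longrightarrow> x - r \<in> L j \<Longrightarrow> r = rep j x"
proof -
  show "rep j x \<in> digits j" using assms by (simp add: digits_def)
  assume r: "r \<in> digits j" "x - r \<in> L j"
  then obtain x' where x': "r = rep j x'" by (auto simp: digits_def)
  have "x - x' \<in> L j"
    using coset_trans[OF r(2)] coset_sym[OF diff_rep[of x' j]] x' by simp
  then show "r = rep j x" using x' rep_eq_iff by metis
qed

primrec walk :: "(nat \<Rightarrow> 'g) \<Rightarrow> nat \<Rightarrow> 'g" where
  "walk \<omega> 0 = 0"
| "walk \<omega> (Suc j) = \<omega> j + walk \<omega> j"

lemma walk_cong: "(\<And>i. i < j \<Longrightarrow> \<omega> i = \<rho> i) \<Longrightarrow> walk \<omega> j = walk \<rho> j"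
  by (induction j) auto

text \<open>Cosets of level \<open>j\<close> correspond to strings of \<open>j\<close> digits, so that all of them have the same
  probability under independent uniform digits.\<close>
lemma walk_coset_digits:
  "\<exists>\<rho>. (\<forall>i. \<rho> i \<in> digits i) \<and> (\<forall>\<omega>. (\<forall>i. \<omega> i \<in> digits i) \<longrightarrow>
    (walk \<omega> j - c \<in> parent j \<longleftrightarrow> (\<forall>i<j. \<omega> i = \<rho> i)))"
proof (induction j)
  case 0
  have "\<forall>i. \<exists>r. r \<in> digits i" using digits_nonempty by blast
  then obtain \<rho> where "\<forall>i. \<rho> i \<in> digits i" by metis
  then show ?case by (auto simp: parent_def)
next
  case (Suc j)
  then obtain \<rho> where \<rho>: "\<And>i. \<rho> i \<in> digits i"
    and iff: "\<And>\<omega>. (\<And>i. \<omega> i \<in> digits i) \<Longrightarrow> walk \<omega> j - c \<in> parent j \<longleftrightarrow> (\<forall>i<j. \<omega> i = \<rho> i)"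
    by blast
  define x where "x = c - walk \<rho> j"
  have x: "x \<in> parent j"
    using parent_minus[of "walk \<rho> j - c" j] iff[of \<rho>] \<rho> by (simp add: x_def)
  define \<rho>' where "\<rho>' = \<rho>(j := rep j x)"
  have \<rho>': "\<rho>' i \<in> digits i" for i using \<rho> unique_digit(1)[OF x] by (simp add: \<rho>'_def)
  have eq: "walk \<omega> (Suc j) - c = \<omega> j - x" if "\<forall>i<j. \<omega> i = \<rho> i" for \<omega>
  proof -
    have "walk \<omega> j = walk \<rho> j" using that by (intro walk_cong) auto
    then show ?thesis
      by (simp add: x_def diff_conv_add_uminus minus_add add.assoc del: add_uminus_conv_diff)
  qed
  have "walk \<omega> (Suc j) - c \<in> parent (Suc j) \<longleftrightarrow> (\<forall>i<Suc j. \<omega> i = \<rho>' i)"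
    if \<omega>: "\<And>i. \<omega> i \<in> digits i" for \<omega>
  proof
    assume *: "walk \<omega> (Suc j) - c \<in> parent (Suc j)"
    have "walk \<omega> (Suc j) - c \<in> parent j" using * subset_parent by auto
    moreover have "\<omega> j \<in> parent j" using \<omega> digits_subset by blast
    ultimately have "- \<omega> j + (walk \<omega> (Suc j) - c) \<in> parent j"
      by (intro parent_add parent_minus)
    then have "walk \<omega> j - c \<in> parent j"
      by (simp add: diff_conv_add_uminus add.assoc del: add_uminus_conv_diff)
    then have \<omega>\<rho>: "\<forall>i<j. \<omega> i = \<rho> i" using iff \<omega> by blast
    then have "\<omega> j - x \<in> L j" using * eq by simp
    then have "\<omega> j = rep j x" using unique_digit(2)[OF x \<omega>] coset_sym by blast
    then show "\<forall>i<Suc j. \<omega> i = \<rho>' i" using \<omega>\<rho> by (auto simp: \<rho>'_def less_Suc_eq)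
  next
    assume *: "\<forall>i<Suc j. \<omega> i = \<rho>' i"
    then have "\<forall>i<j. \<omega> i = \<rho> i" "\<omega> j = rep j x" by (auto simp: \<rho>'_def)
    then show "walk \<omega> (Suc j) - c \<in> parent (Suc j)"
      using eq[of \<omega>] coset_sym[OF diff_rep[of x j]] by (simp del: walk.simps)
  qed
  then show ?case using \<rho>' by blast
qed

definition digit_measure :: "(nat \<Rightarrow> 'g) measure" where
  "digit_measure = PiM UNIV (\<lambda>j. uniform_count_measure (digits j))"

lemma product_prob_space_digits: "product_prob_space (\<lambda>j. uniform_count_measure (digits j))"
  by (intro product_prob_spaceI prob_space_uniform_count_measure finite_digits digits_nonempty)

lemma prob_space_digit_measure: "prob_space digit_measure"
  unfolding digit_measure_def
  by (intro prob_space_PiM prob_space_uniform_count_measure finite_digits digits_nonempty)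

lemma space_digit_measure: "\<omega> \<in> space digit_measure \<longleftrightarrow> (\<forall>i. \<omega> i \<in> digits i)"
  by (auto simp: digit_measure_def space_PiM space_uniform_count_measure PiE_def Pi_def)

lemma measurable_walk [measurable]: "(\<lambda>\<omega>. walk \<omega> j) \<in> measurable digit_measure (count_space UNIV)"
proof (induction j)
  case (Suc j)
  have "(\<lambda>\<omega>. \<omega> j) \<in> measurable digit_measure (uniform_count_measure (digits j))"
    unfolding digit_measure_def by (rule measurable_component_singleton) simp
  moreover have "(\<lambda>x. x) \<in> measurable (uniform_count_measure (digits j)) (count_space UNIV)"
    by (auto simp: measurable_def sets_uniform_count_measure space_uniform_count_measure)
  ultimately have digit: "(\<lambda>\<omega>. \<omega> j) \<in> measurable digit_measure (count_space UNIV)"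
    by (rule measurable_compose)
  have "(\<lambda>\<omega>. \<omega> j + w) \<in> measurable digit_measure (count_space UNIV)" for w
    by (rule measurable_compose[OF digit, of "\<lambda>x. x + w"]) simp
  then show ?case
    unfolding walk.simps by (rule measurable_compose_countable[OF _ Suc.IH])
qed simp

lemma emeasure_walk_coset:
  "emeasure digit_measure {\<omega> \<in> space digit_measure. walk \<omega> j - c \<in> parent j}
    = (\<Prod>i<j. 1 / ennreal (card (digits i)))"
proof -
  interpret product_prob_space "\<lambda>j. uniform_count_measure (digits j)" UNIV
    by (rule product_prob_space_digits)
  obtain \<rho> where \<rho>: "\<And>i. \<rho> i \<in> digits i"
    and iff: "\<And>\<omega>. (\<And>i. \<omega> i \<in> digits i) \<Longrightarrow> walk \<omega> j - c \<in> parent j \<longleftrightarrow> (\<forall>i<j. \<omega> i = \<rho> i)"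
    using walk_coset_digits[of j c] by blast
  have "{\<omega> \<in> space digit_measure. walk \<omega> j - c \<in> parent j}
      = {\<omega> \<in> space (PiM UNIV (\<lambda>j. uniform_count_measure (digits j))). \<forall>i\<in>{..<j}. \<omega> i \<in> {\<rho> i}}"
    using iff space_digit_measure by (auto simp: digit_measure_def)
  also have "emeasure digit_measure \<dots> = (\<Prod>i<j. emeasure (uniform_count_measure (digits i)) {\<rho> i})"
    unfolding digit_measure_def
    by (rule emeasure_PiM_Collect) (use \<rho> in \<open>auto simp: sets_uniform_count_measure\<close>)
  also have "\<dots> = (\<Prod>i<j. 1 / ennreal (card (digits i)))"
    by (intro prod.cong refl) (use \<rho> finite_digits in \<open>simp add: emeasure_uniform_count_measure
      divide_ennreal digits_nonempty card_gt_0_iff flip: ennreal_1\<close>)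
  finally show ?thesis .
qed

lemma measurable_rep_walk:
  "(\<lambda>\<omega> j. rep j (walk \<omega> (Suc j) - g)) \<in> measurable digit_measure (PiM UNIV (\<lambda>_. count_space UNIV))"
proof (rule measurable_PiM_single')
  show "(\<lambda>\<omega>. rep i (walk \<omega> (Suc i) - g)) \<in> digit_measure \<rightarrow>\<^sub>M count_space UNIV" for i
    by (rule measurable_compose[OF measurable_walk, of "\<lambda>w. rep i (w - g)"]) simp
qed auto

text \<open>\<open>walk \<omega> (Suc j)\<close> represents the phase modulo \<open>L j\<close>; later digits do not change it.\<close>
lemma walk_coherent:
  assumes "\<omega> \<in> space digit_measure" and "i \<le> j"
  shows "walk \<omega> (Suc i) - walk \<omega> (Suc j) \<in> L i"
  using \<open>i \<le> j\<close>
proof (induction rule: dec_induct)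
  case (step j)
  have "\<omega> (Suc j) \<in> L j"
    using assms(1) digits_subset[of "Suc j"] by (auto simp: space_digit_measure)
  then have "walk \<omega> (Suc (Suc j)) - walk \<omega> (Suc j) \<in> L i"
    using antimono[OF step(1)] by (auto simp del: walk.simps(2) simp: walk.simps(2)[of _ "Suc j"])
  then show ?case using coset_trans[OF step.IH] coset_sym by blast
qed simp

text \<open>Right translation permutes the cosets of each level, which are equally likely, and by coherence
  the level-\<open>m\<close> coset determines all the earlier ones. The canonical representatives \<open>rep\<close> turn the
  sequence of cosets into a sequence of group elements.\<close>
lemma distr_rep_walk_diff:
  "distr digit_measure (PiM UNIV (\<lambda>_. count_space UNIV)) (\<lambda>\<omega> j. rep j (walk \<omega> (Suc j) - g))
    = distr digit_measure (PiM UNIV (\<lambda>_. count_space UNIV)) (\<lambda>\<omega> j. rep j (walk \<omega> (Suc j) - 0))"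
    (is "?D g = ?D 0")
proof (rule measure_eqI_PiM_infinite)
  show "finite_measure (?D g)"
    using prob_space_digit_measure measurable_rep_walk
    by (intro prob_space.finite_measure prob_space.prob_space_distr)
  fix A :: "nat \<Rightarrow> 'g set" and J :: "nat set"
  assume J: "finite J"
  obtain m where m: "J \<subseteq> {..m}"
    using J finite_nat_iff_bounded_le by blast
  define B where "B = {c. \<forall>j\<in>J. rep j c \<in> A j}"
  let ?C = "\<lambda>g. distr digit_measure (count_space UNIV) (\<lambda>\<omega>. rep m (walk \<omega> (Suc m) - g))"
  have meas: "(\<lambda>\<omega>. rep m (walk \<omega> (Suc m) - g)) \<in> digit_measure \<rightarrow>\<^sub>M count_space UNIV" for g
    by (rule measurable_compose[OF measurable_walk, of "\<lambda>w. rep m (w - g)"]) simp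
  have D: "emeasure (?D g) (prod_emb UNIV (\<lambda>_. count_space UNIV) J (Pi\<^sub>E J A)) = emeasure (?C g) B" for g
  proof -
    have rr: "rep j (walk \<omega> (Suc j) - g) = rep j (rep m (walk \<omega> (Suc m) - g))"
      if "j \<in> J" "\<omega> \<in> space digit_measure" for j \<omega>
    proof -
      have jm: "j \<le> m" using that m by auto
      have "(walk \<omega> (Suc j) - g) - (walk \<omega> (Suc m) - g) \<in> L j"
        using walk_coherent[OF that(2) jm]
        by (simp add: diff_conv_add_uminus minus_add add.assoc del: add_uminus_conv_diff walk.simps)
      moreover have "(walk \<omega> (Suc m) - g) - rep m (walk \<omega> (Suc m) - g) \<in> L j"
        using diff_rep antimono[OF jm] by blast
      ultimately show ?thesis unfolding rep_eq_iff by (rule coset_trans)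
    qed
    have emb: "prod_emb UNIV (\<lambda>_. count_space UNIV) J (Pi\<^sub>E J A) = {z. \<forall>j\<in>J. z j \<in> A j}"
      by (auto simp: prod_emb_def restrict_def PiE_def Pi_def extensional_def)
    have "prod_emb UNIV (\<lambda>_. count_space UNIV) J (Pi\<^sub>E J A) \<in> sets (PiM UNIV (\<lambda>_. count_space UNIV))"
      using J by (intro sets_PiM_I) auto
    then have "emeasure (?D g) (prod_emb UNIV (\<lambda>_. count_space UNIV) J (Pi\<^sub>E J A))
        = emeasure digit_measure ((\<lambda>\<omega> j. rep j (walk \<omega> (Suc j) - g)) -` {z. \<forall>j\<in>J. z j \<in> A j} \<inter> space digit_measure)"
      by (subst emeasure_distr[OF measurable_rep_walk]) (simp_all add: emb)
    also have "(\<lambda>\<omega> j. rep j (walk \<omega> (Suc j) - g)) -` {z. \<forall>j\<in>J. z j \<in> A j} \<inter> space digit_measure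
        = (\<lambda>\<omega>. rep m (walk \<omega> (Suc m) - g)) -` B \<inter> space digit_measure"
      using rr by (auto simp: B_def simp del: walk.simps)
    also have "emeasure digit_measure \<dots> = emeasure (?C g) B"
      by (subst emeasure_distr[OF meas]) simp_all
    finally show ?thesis .
  qed
  have "?C g = ?C 0"
  proof (rule measure_eqI_countable[of _ UNIV])
    fix c :: 'g
    have C: "emeasure (?C g) {c} =
        (if c \<in> range (rep m) then (\<Prod>i<Suc m. 1 / ennreal (card (digits i))) else 0)" for g
    proof -
      have "emeasure (?C g) {c} = emeasure digit_measure ((\<lambda>\<omega>. rep m (walk \<omega> (Suc m) - g)) -` {c} \<inter> space digit_measure)"
        by (subst emeasure_distr[OF meas]) simp_all
      also have "\<dots> = (if c \<in> range (rep m) then (\<Prod>i<Suc m. 1 / ennreal (card (digits i))) else 0)"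
      proof (cases "c \<in> range (rep m)")
        case True
        then obtain d where d: "c = rep m d" by blast
        have "rep m (walk \<omega> (Suc m) - g) = c \<longleftrightarrow> walk \<omega> (Suc m) - (d + g) \<in> parent (Suc m)" for \<omega>
          unfolding d rep_eq_iff
          by (simp add: diff_conv_add_uminus minus_add add.assoc del: add_uminus_conv_diff walk.simps)
        then have "(\<lambda>\<omega>. rep m (walk \<omega> (Suc m) - g)) -` {c} \<inter> space digit_measure
            = {\<omega> \<in> space digit_measure. walk \<omega> (Suc m) - (d + g) \<in> parent (Suc m)}"
          by (auto simp del: walk.simps)
        then show ?thesis using emeasure_walk_coset[of "Suc m" "d + g"] True by (simp del: walk.simps)
      next
        case False
        then have "(\<lambda>\<omega>. rep m (walk \<omega> (Suc m) - g)) -` {c} \<inter> space digit_measure = {}" by auto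
        then show ?thesis using False by (simp del: walk.simps)
      qed
      finally show ?thesis .
    qed
    show "emeasure (?C g) {c} = emeasure (?C 0) {c}" unfolding C ..
  qed auto
  then show "emeasure (?D g) (prod_emb UNIV (\<lambda>_. count_space UNIV) J (Pi\<^sub>E J A))
      = emeasure (?D 0) (prod_emb UNIV (\<lambda>_. count_space UNIV) J (Pi\<^sub>E J A))"
    unfolding D by simp
qed simp_all

end

section \<open>Toeplitz colourings and their invariant measures\<close>

lemma tendsto_pointwise:
  fixes f :: "'n \<Rightarrow> 'a \<Rightarrow> 'b::topological_space"
  assumes "\<And>h. ((\<lambda>n. f n h) \<longlongrightarrow> l h) F"
  shows "(f \<longlongrightarrow> l) F"
proof -
  have "limitin (product_topology (\<lambda>_. euclidean) UNIV) f l F"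
    unfolding limitin_componentwise using assms by simp
  then show ?thesis by (simp add: euclidean_product_topology)
qed

lemma compact_pointwise:
  fixes K :: "'b::topological_space set"
  assumes "compact K"
  shows "compact {x :: 'a \<Rightarrow> 'b. \<forall>h. x h \<in> K}"
proof -
  have "compactin (product_topology (\<lambda>_. euclidean) UNIV) (PiE UNIV (\<lambda>_ :: 'a. K))"
    unfolding compactin_PiE using assms by simp
  then show ?thesis by (simp add: euclidean_product_topology PiE_def Pi_def)
qed

definition shift :: "'g::group_add \<Rightarrow> ('g \<Rightarrow> 'b) \<Rightarrow> 'g \<Rightarrow> 'b" where
  "shift g x h = x (- g + h)"

lemma shift_zero [simp]: "shift 0 x = x"
  by (simp add: shift_def fun_eq_iff)

lemma shift_add: "shift (g + h) x = shift g (shift h x)"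
  by (simp add: shift_def fun_eq_iff minus_add add.assoc diff_conv_add_uminus del: add_uminus_conv_diff)

lemma continuous_on_coordinate: "continuous_on S (\<lambda>x :: 'a \<Rightarrow> 'b::topological_space. x i)"
  by (rule continuous_on_subset[OF continuous_on_product_coordinates]) simp

lemma continuous_shift: "continuous_on S (shift g :: ('g::group_add \<Rightarrow> 'b::topological_space) \<Rightarrow> _)"
  unfolding shift_def[abs_def]
  by (intro continuous_on_coordinatewise_then_product continuous_on_coordinate)

text \<open>The map \<open>turn\<close> is an action on the unit circle. Off the circle its values are
  arbitrary, except that it is a Borel map.\<close>
locale turning_tower = blob_tower N F B
  for N :: "nat \<Rightarrow> 'g::{group_add, countable} set" and F B +
  fixes turn :: "'g \<Rightarrow> complex \<Rightarrow> complex"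
  assumes turn_zero: "norm z = 1 \<Longrightarrow> turn 0 z = z"
    and turn_add: "norm z = 1 \<Longrightarrow> turn (g + h) z = turn g (turn h z)"
    and norm_turn: "norm z = 1 \<Longrightarrow> norm (turn g z) = 1"
    and continuous_turn: "continuous_on (sphere 0 1) (turn g)"
    and measurable_turn [measurable]: "turn g \<in> borel_measurable borel"
begin

definition decided :: "nat \<Rightarrow> 'g \<Rightarrow> bool" where
  "decided j u \<longleftrightarrow> (\<exists>f\<in>F j. u - f \<in> N j)"

text \<open>The position inside the blob: the \<open>f \<in> F j\<close> with \<open>u = n + f\<close> and \<open>n \<in> N j\<close>.\<close>
definition offset :: "nat \<Rightarrow> 'g \<Rightarrow> 'g" where
  "offset j u = (THE f. f \<in> F j \<and> u - f \<in> N j)"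

text \<open>The value \<open>turn (- f) 1\<close> is the direction \<open>n \<cdot> 1\<close> of the blob as seen from the position \<open>n + f\<close>, since
  \<open>- (n + f) + n = - f\<close>. The boolean tells apart the two colourings.\<close>
definition symbol :: "bool \<Rightarrow> nat \<Rightarrow> 'g \<Rightarrow> real \<times> complex" where
  "symbol b j f = (inverse (real (Suc j)), if even j = b then 0 else turn (- f) 1)"

text \<open>The colouring in phase \<open>y\<close>, where \<open>y j\<close> is read modulo \<open>N j\<close>. In a constant phase every position
  is decided; in general the holes are positions that are undecided at all stages, and they get the limit
  value \<open>(0, 0)\<close>.\<close>
definition pattern :: "bool \<Rightarrow> (nat \<Rightarrow> 'g) \<Rightarrow> 'g \<Rightarrow> real \<times> complex" where
  "pattern b y h = (if \<exists>j. decided j (y j + h)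
     then (let j = LEAST j. decided j (y j + h) in symbol b j (offset j (y j + h))) else 0)"

definition base :: "bool \<Rightarrow> 'g \<Rightarrow> real \<times> complex" where
  "base b = pattern b (\<lambda>_. 0)"

definition orbit_closure :: "bool \<Rightarrow> ('g \<Rightarrow> real \<times> complex) set" where
  "orbit_closure b = closure (range (\<lambda>g. shift g (base b)))"

lemma offset_eqI: "f \<in> F j \<Longrightarrow> u - f \<in> N j \<Longrightarrow> offset j u = f"
  unfolding offset_def
proof (rule the_equality)
  fix f' assume f: "f \<in> F j" "u - f \<in> N j" and f': "f' \<in> F j \<and> u - f' \<in> N j"
  have "f' - f \<in> N j" using coset_trans[of f' u j f] coset_sym f f' by blast
  then show "f' = f" using translates_disjoint[of f' j f] F_subset_B f f' by blast
qed simp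

lemma offset:
  assumes "decided j u"
  shows "offset j u \<in> F j" and "u - offset j u \<in> N j"
  using assms offset_eqI[of _ j u] unfolding decided_def by blast+

lemma decided_cong: "u - v \<in> N j \<Longrightarrow> decided j u \<longleftrightarrow> decided j v"
  unfolding decided_def using coset_trans coset_sym by blast

lemma offset_cong: "u - v \<in> N j \<Longrightarrow> decided j u \<Longrightarrow> offset j v = offset j u"
  using offset[of j u] coset_trans[OF coset_sym] by (intro offset_eqI) blast+

lemma diff_translate: "(x + h) - (y + h) = x - (y :: 'g)"
  by (simp add: diff_conv_add_uminus minus_add add.assoc del: add_uminus_conv_diff)

lemma pattern_eqI:
  assumes "decided j (y j + h)" "\<And>i. i < j \<Longrightarrow> \<not> decided i (y i + h)"
  shows "pattern b y h = symbol b j (offset j (y j + h))"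
proof -
  have "(LEAST j. decided j (y j + h)) = j"
    using assms by (intro Least_equality) (auto simp: not_less[symmetric])
  then show ?thesis using assms unfolding pattern_def Let_def by auto
qed

lemma pattern_hole: "(\<And>j. \<not> decided j (y j + h)) \<Longrightarrow> pattern b y h = 0"
  by (simp add: pattern_def)

lemma first_decided:
  assumes "decided k (y k + h)"
  obtains j where "j \<le> k" "decided j (y j + h)" "\<And>i. i < j \<Longrightarrow> \<not> decided i (y i + h)"
    "\<And>b. pattern b y h = symbol b j (offset j (y j + h))"
proof
  define j where "j = (LEAST j. decided j (y j + h))"
  show 1: "decided j (y j + h)" unfolding j_def by (rule LeastI) fact
  show 2: "\<not> decided i (y i + h)" if "i < j" for i using not_less_Least that unfolding j_def by blast
  show "j \<le> k" unfolding j_def by (rule Least_le) fact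
  show "pattern b y h = symbol b j (offset j (y j + h))" for b by (rule pattern_eqI[OF 1 2])
qed

lemma pattern_local:
  assumes "\<And>i. i \<le> j \<Longrightarrow> y i - y' i \<in> N i"
    and "decided j (y j + h)" "\<And>i. i < j \<Longrightarrow> \<not> decided i (y i + h)"
  shows "pattern b y' h = pattern b y h"
proof -
  have co: "(y i + h) - (y' i + h) \<in> N i" if "i \<le> j" for i
    using assms(1)[OF that] by (simp add: diff_translate)
  have "pattern b y' h = symbol b j (offset j (y' j + h))"
    using assms(2,3) decided_cong[OF co] by (intro pattern_eqI) auto
  also have "offset j (y' j + h) = offset j (y j + h)"
    using co assms(2) by (intro offset_cong) auto
  finally show ?thesis using pattern_eqI[OF assms(2,3)] by simp
qed

lemma pattern_cong:
  assumes "\<And>j. y j - y' j \<in> N j"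
  shows "pattern b y = pattern b y'"
proof
  fix h
  have co: "(y i + h) - (y' i + h) \<in> N i" for i
    using assms by (simp add: diff_translate)
  show "pattern b y h = pattern b y' h"
  proof (cases "\<exists>j. decided j (y j + h)")
    case True
    then obtain k where "decided k (y k + h)" by blast
    then show ?thesis using first_decided[of k y h] pattern_local[of _ y y' h b] assms by metis
  next
    case False
    then show ?thesis using decided_cong[OF co] by (simp add: pattern_hole)
  qed
qed

lemma shift_pattern: "shift g (pattern b y) = pattern b (\<lambda>j. y j - g)"
  by (simp add: fun_eq_iff shift_def pattern_def diff_conv_add_uminus add.assoc del: add_uminus_conv_diff)

lemma shift_base: "shift g (base b) = pattern b (\<lambda>_. - g)"
  by (simp add: base_def shift_pattern)

lemma decided_window:
  assumes "h \<in> window j"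
  shows "decided j h"
  using assms window_subset_F[of j] unfolding decided_def by (intro bexI[of _ h]) auto

lemma base_symbol:
  obtains j where "decided j u" "\<And>i. i < j \<Longrightarrow> \<not> decided i u" "\<And>b. base b u = symbol b j (offset j u)"
proof -
  obtain k where "u \<in> window k"
    using window_exhausts[of "{u}"] by auto
  then have "decided k ((\<lambda>_. 0) k + u)" using decided_window by simp
  then obtain j where j: "decided j (0 + u)" "\<And>i. i < j \<Longrightarrow> \<not> decided i (0 + u)"
      "\<And>b. pattern b (\<lambda>_. 0) u = symbol b j (offset j (0 + u))"
    by (rule first_decided) blast
  show ?thesis
    by (rule that[of j]) (use j in \<open>simp_all only: base_def add_0 not_False_eq_True\<close>)
qed

lemma base_periodic: "\<exists>i. \<forall>n\<in>N i. base b (n + h) = base b h"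
proof -
  obtain j where j: "decided j h" "\<And>i. i < j \<Longrightarrow> \<not> decided i h"
    using base_symbol[of h] by metis
  have "base b (n + h) = base b h" if "n \<in> N j" for n
  proof -
    have "pattern b (\<lambda>_. n) h = pattern b (\<lambda>_. 0) h"
    proof (rule pattern_local[of j])
      show "0 - n \<in> N i" if "i \<le> j" for i
        using antimono[OF that] \<open>n \<in> N j\<close> minus_mem by auto
    qed (use j in auto)
    moreover have "pattern b (\<lambda>_. n) h = base b (n + h)"
      by (simp only: base_def pattern_def add_0)
    ultimately show ?thesis by (simp add: base_def)
  qed
  then show ?thesis by blast
qed

lemma base_periodic_finite: "finite W \<Longrightarrow> \<exists>i. \<forall>n\<in>N i. \<forall>h\<in>W. base b (n + h) = base b h"
proof (induction rule: finite_induct)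
  case (insert h W)
  then obtain i where i: "\<forall>n\<in>N i. \<forall>h\<in>W. base b (n + h) = base b h" by blast
  obtain i' where i': "\<forall>n\<in>N i'. base b (n + h) = base b h" using base_periodic by blast
  have "\<forall>n\<in>N (max i i'). \<forall>h\<in>insert h W. base b (n + h) = base b h"
    using i i' antimono[of i "max i i'"] antimono[of i' "max i i'"] by auto
  then show ?case ..
qed simp

lemma norm_symbol: "fst (symbol b j f) \<in> {0..1}" "snd (symbol b j f) \<in> cball 0 1"
  by (auto simp: symbol_def norm_turn inverse_le_1_iff)

lemma orbit_closure_subset: "orbit_closure b \<subseteq> {x. \<forall>h. x h \<in> {0..1} \<times> cball 0 1}"
  unfolding orbit_closure_def
proof (rule closure_minimal)
  have "pattern b y h \<in> {0..1} \<times> cball 0 1" for y h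
  proof (cases "\<exists>k. decided k (y k + h)")
    case True
    then obtain k where "decided k (y k + h)" by blast
    then obtain j where "pattern b y h = symbol b j (offset j (y j + h))"
      by (rule first_decided) blast
    then show ?thesis using norm_symbol[of b j "offset j (y j + h)"] by (metis mem_Times_iff)
  qed (simp add: pattern_hole zero_prod_def)
  then show "range (\<lambda>g. shift g (base b)) \<subseteq> {x. \<forall>h. x h \<in> {0..1} \<times> cball 0 1}"
    by (auto simp: shift_base)
  show "closed {x :: 'g \<Rightarrow> real \<times> complex. \<forall>h. x h \<in> {0..1} \<times> cball 0 1}"
    by (intro compact_imp_closed compact_pointwise compact_Times) auto
qed

lemma compact_orbit_closure: "compact (orbit_closure b)"
proof -
  have "compact {x :: 'g \<Rightarrow> real \<times> complex. \<forall>h. x h \<in> {0..1} \<times> cball 0 1}"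
    by (intro compact_pointwise compact_Times) auto
  moreover have "closed (orbit_closure b)" by (simp add: orbit_closure_def)
  ultimately show ?thesis
    using orbit_closure_subset[of b] by (metis compact_Int_closed inf.absorb_iff2)
qed

lemma shift_orbit_closure:
  assumes "x \<in> orbit_closure b"
  shows "shift g x \<in> orbit_closure b"
proof -
  have "shift g ` closure (range (\<lambda>g. shift g (base b))) \<subseteq> closure (range (\<lambda>g. shift g (base b)))"
    by (rule image_closure_subset[OF continuous_shift])
      (auto intro!: closure_subset[THEN subsetD] simp flip: shift_add)
  then show ?thesis using assms by (auto simp: orbit_closure_def)
qed

lemma base_in_orbit_closure: "base b \<in> orbit_closure b"
  unfolding orbit_closure_def by (rule closure_subset[THEN subsetD]) (auto intro: image_eqI[of _ _ 0])

text \<open>On a finite window the base colouring is periodic along some \<open>N i\<close>. As \<open>N i\<close> has finite index,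
  finitely many shifts suffice to bring each point of the orbit, hence each point of its closure, into agreement
  with the base colouring on that window.\<close>
lemma minimal_orbit_closure:
  assumes "closed C" "\<And>g x. x \<in> C \<Longrightarrow> shift g x \<in> C" "x \<in> C" "x \<in> orbit_closure b"
  shows "orbit_closure b \<subseteq> C"
proof -
  have "\<exists>c\<in>C. \<forall>h\<in>window n. c h = base b h" for n
  proof -
    obtain i where i: "\<forall>n'\<in>N i. \<forall>h\<in>window n. base b (n' + h) = base b h"
      using base_periodic_finite[of "window n"] by auto
    obtain R where R: "finite R" "\<And>g. \<exists>r\<in>R. g - r \<in> N i" using finite_index by blast
    define T where "T = {x. \<forall>h\<in>window n. x h = base b h}"
    have "T = (\<Inter>h\<in>window n. {x. x h = base b h})" by (auto simp: T_def)
    then have "closed T"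
      by (auto intro!: closed_INT closed_Collect_eq continuous_on_coordinate continuous_on_const)
    then have "closed (shift r -` T)" for r
      by (rule closed_vimage) (rule continuous_shift)
    then have "closed (\<Union>r\<in>R. shift r -` T)" using R(1) by (intro closed_UN) auto
    moreover have "range (\<lambda>g. shift g (base b)) \<subseteq> (\<Union>r\<in>R. shift r -` T)"
    proof
      fix z assume "z \<in> range (\<lambda>g. shift g (base b))"
      then obtain g where z: "z = shift g (base b)" by blast
      obtain r where r: "r \<in> R" "- g - r \<in> N i" using R(2) by blast
      then have "shift r z h = base b h" if "h \<in> window n" for h
        using i that by (simp add: z shift_def add.assoc[symmetric])
      then show "z \<in> (\<Union>r\<in>R. shift r -` T)" using r by (auto simp: T_def)
    qed
    ultimately have "orbit_closure b \<subseteq> (\<Union>r\<in>R. shift r -` T)"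
      unfolding orbit_closure_def by (rule closure_minimal[rotated])
    then obtain r where "shift r x \<in> T" using assms(4) by blast
    then show ?thesis using assms(2,3) by (auto simp: T_def)
  qed
  then obtain c where c: "\<And>n. c n \<in> C" "\<And>n h. h \<in> window n \<Longrightarrow> c n h = base b h" by metis
  have "(\<lambda>n. c n h) \<longlonglongrightarrow> base b h" for h
  proof (rule tendsto_eventually)
    obtain k where "h \<in> window k" using window_exhausts[of "{h}"] by auto
    then show "eventually (\<lambda>n. c n h = base b h) sequentially"
      using c(2) window_mono by (intro eventually_sequentiallyI[of k]) blast
  qed
  then have "c \<longlonglongrightarrow> base b" by (rule tendsto_pointwise)
  then have "base b \<in> C" using closed_sequentially[OF assms(1)] c(1) by blast
  then show ?thesis
    unfolding orbit_closure_def using assms(1,2) by (intro closure_minimal) auto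
qed

text \<open>Shift the base colouring so that it is in the phase \<open>y (I n)\<close> modulo \<open>N (I n)\<close> and the window
  lies in the next blob \<open>F (J n)\<close>, where \<open>J n = I n + 1\<close> has the parity that writes \<open>0\<close>. Then all
  positions that the phase \<open>y\<close> decides by stage \<open>I n\<close> agree, and all the others show \<open>(1 / (J n + 1), 0)\<close>,
  which tends to the value at a hole.\<close>
lemma pattern_in_orbit_closure:
  assumes coherent: "\<And>i j. i \<le> j \<Longrightarrow> y i - y j \<in> N i"
  shows "pattern b y \<in> orbit_closure b"
proof -
  define J where "J n = (if b then 2 * n + 2 else 2 * n + 1)" for n :: nat
  define I where "I n = J n - 1" for n
  have JI: "J n = Suc (I n)" for n by (simp add: J_def I_def)
  have even: "even (J n) = b" for n by (simp add: J_def)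
  have large: "n \<le> I n" for n by (simp add: J_def I_def)
  have "\<forall>n. \<exists>r. y (I n) - r \<in> N (I n) \<and> (\<forall>w\<in>window (J n). r + w \<in> F (J n))"
    using transversal JI by simp
  then obtain r where r: "\<And>n. y (I n) - r n \<in> N (I n)" "\<And>n w. w \<in> window (J n) \<Longrightarrow> r n + w \<in> F (J n)"
    by metis
  define c where "c n = shift (- r n) (base b)" for n
  have c: "c n = pattern b (\<lambda>_. r n)" for n by (simp add: c_def shift_base)
  have yr: "y i - r n \<in> N i" if "i \<le> I n" for i n
    using coset_trans[OF coherent[OF that], of "r n"] r(1)[of n] antimono[OF that] by blast
  have "(\<lambda>n. c n h) \<longlonglongrightarrow> pattern b y h" for h
  proof (cases "\<exists>k. decided k (y k + h)")
    case True
    then obtain k where "decided k (y k + h)" by blast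
    then obtain j where j: "decided j (y j + h)" "\<And>i. i < j \<Longrightarrow> \<not> decided i (y i + h)"
      by (rule first_decided) blast
    have "c n h = pattern b y h" if "j \<le> n" for n
      unfolding c using yr that large[of n] by (intro pattern_local[OF _ j]) auto
    then show ?thesis
      by (intro tendsto_eventually eventually_sequentiallyI[of j])
  next
    case False
    obtain k where k: "h \<in> window k" using window_exhausts[of "{h}"] by auto
    have "c n h = (inverse (real (Suc (J n))), 0)" if "k \<le> n" for n
    proof -
      have "h \<in> window (J n)" using k window_mono[of k "J n"] that large[of n] JI[of n] by auto
      then have rF: "r n + h \<in> F (J n)" by (rule r(2))
      have "c n h = symbol b (J n) (offset (J n) (r n + h))"
        unfolding c
      proof (rule pattern_eqI)
        show "decided (J n) (r n + h)" using rF unfolding decided_def by (intro bexI[of _ "r n + h"]) auto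
        show "\<not> decided i (r n + h)" if "i < J n" for i
          using False decided_cong[of "y i + h" "r n + h" i] yr[of i n] that JI[of n]
          by (auto simp: diff_translate)
      qed
      then show ?thesis by (simp add: symbol_def even)
    qed
    then have "eventually (\<lambda>n. (inverse (real (Suc (J n))), 0) = c n h) sequentially"
      by (intro eventually_sequentiallyI[of k]) simp
    moreover have "(\<lambda>n. (inverse (real (Suc (J n))), 0 :: complex)) \<longlonglongrightarrow> (0, 0)"
    proof (intro tendsto_Pair tendsto_const)
      have "filterlim J at_top sequentially"
        by (rule filterlim_at_top_mono[OF filterlim_ident]) (use large JI in \<open>auto intro!: always_eventually le_SucI\<close>)
      then show "(\<lambda>n. inverse (real (Suc (J n)))) \<longlonglongrightarrow> 0"
        by (rule filterlim_compose[OF LIMSEQ_inverse_real_of_nat])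
    qed
    ultimately show ?thesis
      using False by (simp add: pattern_hole zero_prod_def tendsto_cong)
  qed
  then have "c \<longlonglongrightarrow> pattern b y" by (rule tendsto_pointwise)
  moreover have "c n \<in> orbit_closure b" for n
    unfolding c_def by (intro shift_orbit_closure base_in_orbit_closure)
  ultimately show ?thesis
    using closed_sequentially[of "orbit_closure b" c] by (simp add: orbit_closure_def)
qed

lemma measurable_pattern: "pattern b \<in> borel_measurable (PiM UNIV (\<lambda>_. count_space UNIV))"
proof (rule measurable_coordinatewise_then_product)
  fix h
  have comp: "(\<lambda>y. q (y j)) \<in> PiM UNIV (\<lambda>_. count_space UNIV) \<rightarrow>\<^sub>M M"
    if "\<And>u. q u \<in> space M" for q :: "'g \<Rightarrow> 'c" and j :: nat and M
    by (rule measurable_compose[OF measurable_component_singleton]) (use that in auto)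
  have [measurable]: "Measurable.pred (PiM UNIV (\<lambda>_. count_space UNIV)) (\<lambda>y. decided j (y j + h))" for j
    by (rule comp) simp
  have [measurable]: "(\<lambda>y. symbol b j (offset j (y j + h))) \<in> borel_measurable (PiM UNIV (\<lambda>_. count_space UNIV))" for j
    by (rule comp) simp
  have "(\<lambda>y. let j = LEAST j. decided j (y j + h) in symbol b j (offset j (y j + h)))
      \<in> borel_measurable (PiM UNIV (\<lambda>_. count_space UNIV))"
    unfolding Let_def
    by (rule measurable_compose_countable[where f = "\<lambda>j y. symbol b j (offset j (y j + h))"
          and g = "\<lambda>y. LEAST j. decided j (y j + h)"]) measurable
  then show "(\<lambda>y. pattern b y h) \<in> borel_measurable (PiM UNIV (\<lambda>_. count_space UNIV))"
    unfolding pattern_def by measurable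
qed

text \<open>The pattern is an equivariant function of the phase, so it maps the invariant distribution of
  the phase to an invariant measure.\<close>
lemma invariant_measure_orbit_closure:
  "\<exists>M. prob_space M \<and> sets M = sets borel \<and> emeasure M (orbit_closure b) = 1 \<and>
     (\<forall>g. distr M borel (shift g) = M)"
proof -
  interpret prob_space digit_measure by (rule prob_space_digit_measure)
  define K where "K = PiM UNIV (\<lambda>_ :: nat. count_space (UNIV :: 'g set))"
  define \<kappa> where "\<kappa> g = (\<lambda>\<omega> j. rep j (walk \<omega> (Suc j) - g))" for g
  have \<kappa> [measurable]: "\<kappa> g \<in> measurable digit_measure K" for g
    unfolding \<kappa>_def K_def by (rule measurable_rep_walk)
  have pat [measurable]: "pattern b \<in> borel_measurable K"
    unfolding K_def by (rule measurable_pattern)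
  have shift_meas [measurable]: "shift g \<in> borel_measurable borel" for g :: 'g
    by (rule borel_measurable_continuous_onI) (rule continuous_shift)
  define M where "M = distr digit_measure borel (\<lambda>\<omega>. pattern b (\<kappa> 0 \<omega>))"
  have "shift g (pattern b (\<kappa> 0 \<omega>)) = pattern b (\<kappa> g \<omega>)" for g \<omega>
  proof -
    have "pattern b (\<kappa> g' \<omega>) = pattern b (\<lambda>j. walk \<omega> (Suc j) - g')" for g'
      unfolding \<kappa>_def using coset_sym[OF diff_rep] by (intro pattern_cong) blast
    from this[of 0] this[of g] show ?thesis by (simp add: shift_pattern del: walk.simps)
  qed
  then have "distr M borel (shift g) = distr digit_measure borel (\<lambda>\<omega>. pattern b (\<kappa> g \<omega>))" for g
    unfolding M_def by (subst distr_distr) (auto simp: o_def)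
  also have "\<dots> g = distr (distr digit_measure K (\<kappa> g)) borel (pattern b)" for g
    by (subst distr_distr) (auto simp: o_def)
  also have "\<dots> g = distr (distr digit_measure K (\<kappa> 0)) borel (pattern b)" for g
    unfolding \<kappa>_def K_def by (subst distr_rep_walk_diff) simp
  also have "\<dots> = M"
    unfolding M_def by (subst distr_distr) (auto simp: o_def)
  finally have inv: "distr M borel (shift g) = M" for g .
  have "pattern b (\<kappa> 0 \<omega>) \<in> orbit_closure b" if "\<omega> \<in> space digit_measure" for \<omega>
  proof -
    have "pattern b (\<kappa> 0 \<omega>) = pattern b (\<lambda>j. walk \<omega> (Suc j) - 0)"
      unfolding \<kappa>_def using coset_sym[OF diff_rep] by (intro pattern_cong) blast
    also have "\<dots> \<in> orbit_closure b"
      using walk_coherent[OF that] by (intro pattern_in_orbit_closure) (simp del: walk.simps)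
    finally show ?thesis .
  qed
  then have "(\<lambda>\<omega>. pattern b (\<kappa> 0 \<omega>)) -` orbit_closure b \<inter> space digit_measure = space digit_measure"
    by auto
  moreover have "orbit_closure b \<in> sets borel" by (simp add: orbit_closure_def)
  ultimately have "emeasure M (orbit_closure b) = 1"
    unfolding M_def by (subst emeasure_distr) (auto simp: emeasure_space_1)
  moreover have "prob_space M" "sets M = sets borel"
    unfolding M_def by (auto intro!: prob_space_distr)
  ultimately show ?thesis using inv by blast
qed

lemma invariant_measure_subflow:
  assumes "closed C" "C \<subseteq> orbit_closure True \<union> orbit_closure False" "C \<noteq> {}"
    "\<And>g x. x \<in> C \<Longrightarrow> shift g x \<in> C"
  shows "\<exists>M. prob_space M \<and> sets M = sets borel \<and> emeasure M C = 1 \<and> (\<forall>g. distr M borel (shift g) = M)"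
proof -
  obtain x b where "x \<in> C" "x \<in> orbit_closure b" using assms(2,3) by blast
  then have sub: "orbit_closure b \<subseteq> C" using minimal_orbit_closure assms by blast
  obtain M where M: "prob_space M" "sets M = sets borel" "emeasure M (orbit_closure b) = 1"
    "\<forall>g. distr M borel (shift g) = M"
    using invariant_measure_orbit_closure by blast
  have "emeasure M (orbit_closure b) \<le> emeasure M C"
    using sub assms(1) M(2) by (intro emeasure_mono) auto
  then have "emeasure M C = 1"
    using M(3) prob_space.emeasure_le_1[OF M(1), of C] by (intro antisym) simp_all
  then show ?thesis using M(1,2,4) by (intro exI[of _ M]) simp
qed

end

section \<open>The joint orbit closure of the two colourings\<close>

lemma continuous_entry:
  fixes S :: "(('a \<Rightarrow> 'b::topological_space) \<times> ('a \<Rightarrow> 'b)) set"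
  shows "continuous_on S (\<lambda>p. fst p h)" and "continuous_on S (\<lambda>p. snd p h)"
proof -
  show "continuous_on S (\<lambda>p. fst p h)"
    by (rule continuous_on_compose2[OF continuous_on_coordinate[of UNIV h] continuous_on_fst[OF continuous_on_id]])
      simp
  show "continuous_on S (\<lambda>p. snd p h)"
    by (rule continuous_on_compose2[OF continuous_on_coordinate[of UNIV h] continuous_on_snd[OF continuous_on_id]])
      simp
qed

context turning_tower
begin

definition stage :: "'g \<Rightarrow> nat" where
  "stage u = (LEAST j. decided j u)"

text \<open>The element \<open>n\<close> of \<open>N (stage u)\<close> that names the blob \<open>n + F (stage u)\<close> of the position \<open>u\<close>.\<close>
definition anchor :: "'g \<Rightarrow> 'g" where
  "anchor u = u - offset (stage u) u"

lemma decided_stage: "decided (stage u) u"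
  and not_decided_before: "i < stage u \<Longrightarrow> \<not> decided i u"
  and base_stage: "base b u = symbol b (stage u) (offset (stage u) u)"
proof -
  obtain j where j: "decided j u" "\<And>i. i < j \<Longrightarrow> \<not> decided i u" "\<And>b. base b u = symbol b j (offset j u)"
    using base_symbol by blast
  have "stage u = j"
    unfolding stage_def using j by (intro Least_equality) (auto simp: not_less[symmetric])
  then show "decided (stage u) u" "i < stage u \<Longrightarrow> \<not> decided i u"
      "base b u = symbol b (stage u) (offset (stage u) u)"
    using j by auto
qed

lemma anchor_mem: "anchor u \<in> N (stage u)"
  unfolding anchor_def using offset(2)[OF decided_stage] .

lemma anchor_eqI:
  assumes "n \<in> N (stage u)" "- n + u \<in> F (stage u)"
  shows "anchor u = n"
proof -
  have "offset (stage u) u = - n + u"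
    using assms by (intro offset_eqI) (auto simp: diff_conv_add_uminus minus_add add.assoc[symmetric] simp del: add_uminus_conv_diff)
  then show ?thesis
    by (simp add: anchor_def diff_conv_add_uminus minus_add add.assoc[symmetric] del: add_uminus_conv_diff)
qed

text \<open>If the blob of \<open>u1\<close>, the earliest one, does not contain \<open>u2\<close>, then the blob of \<open>u2\<close> belongs to a
  later stage, because distinct blobs of the same stage are separated by their margins. The later
  blob meets the margin of the blob of \<open>u1\<close>, in which \<open>u3\<close> lies too, so by nesting it contains \<open>u3\<close>.\<close>
lemma blob_cut_once:
  assumes le: "stage u1 \<le> stage u2" "stage u2 \<le> stage u3"
    and w: "w1 \<in> window (stage u1)" "w2 \<in> window (stage u1)" "w3 \<in> window (stage u1)"
    and u: "u2 = u1 - w1 + w2" "u3 = u1 - w1 + w3"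
  shows "anchor u1 = anchor u2 \<or> anchor u2 = anchor u3"
proof (rule disjCI)
  assume ne: "anchor u2 \<noteq> anchor u3"
  show "anchor u1 = anchor u2"
  proof (rule ccontr)
    assume ne': "anchor u1 \<noteq> anchor u2"
    let ?j = "stage u1" and ?k = "stage u2" and ?n = "anchor u1" and ?m = "anchor u2"
    have f1: "- ?n + u1 \<in> F ?j"
      using offset(1)[OF decided_stage, of u1]
      by (simp add: anchor_def diff_conv_add_uminus minus_add add.assoc del: add_uminus_conv_diff)
    have f2: "- ?m + u2 \<in> F ?k"
      using offset(1)[OF decided_stage, of u2]
      by (simp add: anchor_def diff_conv_add_uminus minus_add add.assoc del: add_uminus_conv_diff)
    have b2: "- ?n + u2 \<in> B ?j"
      using margin[OF f1 w(1,2)] u by (simp add: diff_conv_add_uminus add.assoc del: add_uminus_conv_diff)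
    have b3: "- ?n + u3 \<in> B ?j"
      using margin[OF f1 w(1,3)] u by (simp add: diff_conv_add_uminus add.assoc del: add_uminus_conv_diff)
    have n: "?n \<in> N ?j" and m: "?m \<in> N ?k" by (rule anchor_mem)+
    then have mn: "- ?m + ?n \<in> N ?j"
      using antimono[OF le(1)] by (intro add_mem minus_mem) auto
    have "?j \<noteq> ?k"
    proof
      assume jk: "?j = ?k"
      have "(- ?m + u2) - (- ?n + u2) = - ?m + ?n"
        by (simp add: diff_conv_add_uminus minus_add add.assoc del: add_uminus_conv_diff)
      then have "- ?m + u2 = - ?n + u2"
        using translates_disjoint[of "- ?m + u2" ?j "- ?n + u2"] f2 F_subset_B[of ?k] b2 mn jk by auto
      then show False using ne' by simp
    qed
    then have "?j < ?k" using le(1) by simp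
    moreover have "(- ?m + ?n) + (- ?n + u2) \<in> F ?k"
      using f2 by (simp add: add.assoc)
    ultimately have "(- ?m + ?n) + (- ?n + u3) \<in> F ?k"
      using nested[of ?k] mn b2 b3 unfolding saturated_def by blast
    then have f3: "- ?m + u3 \<in> F ?k" by (simp add: add.assoc)
    have "decided ?k u3"
      unfolding decided_def
      using f3 m by (intro bexI[of _ "- ?m + u3"])
        (simp_all add: diff_conv_add_uminus minus_add add.assoc[symmetric] del: add_uminus_conv_diff)
    then have "stage u3 = ?k" using le(2) not_decided_before[of ?k u3] by (auto simp: order_le_less)
    then have "anchor u3 = ?m" using f3 m by (intro anchor_eqI) auto
    then show False using ne by simp
  qed
qed

text \<open>The pairs below consist of a limit of shifts of \<open>base True\<close> and a limit of the same shifts of \<open>base False\<close>. The age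
  of a position can be read off from either component, and it vanishes exactly at the holes. The sum in
  \<open>heading\<close> picks the component that is not \<open>0\<close>, and \<open>direction\<close> undoes the dependence on the
  position within the blob.\<close>
definition age :: "('g \<Rightarrow> real \<times> complex) \<times> ('g \<Rightarrow> real \<times> complex) \<Rightarrow> 'g \<Rightarrow> real" where
  "age p h = fst (fst p h)"

definition heading :: "('g \<Rightarrow> real \<times> complex) \<times> ('g \<Rightarrow> real \<times> complex) \<Rightarrow> 'g \<Rightarrow> complex" where
  "heading p h = snd (fst p h) + snd (snd p h)"

definition direction :: "('g \<Rightarrow> real \<times> complex) \<times> ('g \<Rightarrow> real \<times> complex) \<Rightarrow> 'g \<Rightarrow> complex" where
  "direction p h = turn h (heading p h)"

definition orbit_point :: "'g \<Rightarrow> ('g \<Rightarrow> real \<times> complex) \<times> ('g \<Rightarrow> real \<times> complex)" where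
  "orbit_point g = (shift g (base True), shift g (base False))"

definition pair_closure :: "(('g \<Rightarrow> real \<times> complex) \<times> ('g \<Rightarrow> real \<times> complex)) set" where
  "pair_closure = closure (range orbit_point)"

lemma age_orbit: "age (orbit_point g) h = inverse (real (Suc (stage (- g + h))))"
  by (simp add: age_def orbit_point_def shift_def base_stage symbol_def)

lemma heading_orbit: "heading (orbit_point g) h = turn (- offset (stage (- g + h)) (- g + h)) 1"
  by (simp add: heading_def orbit_point_def shift_def base_stage symbol_def)

lemma direction_orbit: "direction (orbit_point g) h = turn (g + anchor (- g + h)) 1"
proof -
  have "direction (orbit_point g) h = turn (h + - offset (stage (- g + h)) (- g + h)) 1"
    unfolding direction_def heading_orbit by (rule turn_add[symmetric]) simp
  also have "h + - offset (stage (- g + h)) (- g + h) = g + anchor (- g + h)"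
    by (simp add: anchor_def diff_conv_add_uminus add.assoc[symmetric] del: add_uminus_conv_diff)
  finally show ?thesis .
qed

lemma continuous_age: "continuous_on UNIV (\<lambda>p. age p h)"
  unfolding age_def by (rule continuous_on_fst[OF continuous_entry(1)])

lemma continuous_heading: "continuous_on S (\<lambda>p. heading p h)"
  unfolding heading_def
  by (intro continuous_on_add continuous_on_snd continuous_entry)

lemma pair_closure_minimal:
  assumes "closed A" "\<And>g. orbit_point g \<in> A" "p \<in> pair_closure"
  shows "p \<in> A"
  using closure_minimal[of "range orbit_point" A] assms by (auto simp: pair_closure_def)

lemma norm_heading: "p \<in> pair_closure \<Longrightarrow> norm (heading p h) = 1"
proof -
  assume p: "p \<in> pair_closure"
  have "closed {p. norm (heading p h) = 1}"
    by (intro closed_Collect_eq continuous_on_norm continuous_heading continuous_on_const)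
  then have "p \<in> {p. norm (heading p h) = 1}"
    by (rule pair_closure_minimal[OF _ _ p]) (simp add: heading_orbit norm_turn)
  then show ?thesis by simp
qed

lemma norm_direction: "p \<in> pair_closure \<Longrightarrow> norm (direction p h) = 1"
  unfolding direction_def by (intro norm_turn norm_heading)

text \<open>The values \<open>1 / (i + 1)\<close> are isolated among all ages, so excluding an age is a closed condition, which
  passes to orbit closures.\<close>
lemma closed_age_range: "closed (insert 0 (range (\<lambda>i. if i \<in> I then 0 else inverse (real (Suc i)))))"
proof (intro compact_imp_closed compact_sequence_with_limit)
  show "(\<lambda>i. if i \<in> I then 0 else inverse (real (Suc i))) \<longlonglongrightarrow> 0"
    by (rule tendsto_sandwich[OF _ _ tendsto_const LIMSEQ_inverse_real_of_nat]) auto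
qed

lemma age_values:
  assumes "p \<in> pair_closure"
  shows "age p h = 0 \<or> (\<exists>j. age p h = inverse (real (Suc j)))"
proof -
  have "closed {p. age p h \<in> insert 0 (range (\<lambda>i. inverse (real (Suc i))))}"
    using closed_vimage[OF closed_age_range[of "{}"] continuous_age] by (simp add: vimage_def)
  then have "p \<in> {p. age p h \<in> insert 0 (range (\<lambda>i. inverse (real (Suc i))))}"
    by (rule pair_closure_minimal) (auto simp: age_orbit assms)
  then show ?thesis by auto
qed

text \<open>Positions \<open>c\<close> and \<open>c'\<close> whose copies \<open>N j + F j - c\<close> and \<open>N j + F j - c'\<close> are disjoint never both have stage \<open>j\<close>.\<close>
lemma age_sparse:
  assumes p: "p \<in> pair_closure" and "c \<noteq> c'"
    and far: "\<And>f f'. f \<in> F j \<Longrightarrow> f' \<in> F j \<Longrightarrow> (f - c) - (f' - c') \<in> N j \<Longrightarrow> c = c'"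
    and age: "age p c = inverse (real (Suc j))"
  shows "age p c' \<noteq> inverse (real (Suc j))"
proof -
  define V where "V = insert 0 (range (\<lambda>i. if i \<in> {j} then 0 else inverse (real (Suc i))))"
  have V: "closed V" unfolding V_def by (rule closed_age_range)
  have in_V: "inverse (real (Suc i)) \<in> V \<longleftrightarrow> i \<noteq> j" for i
  proof
    assume "inverse (real (Suc i)) \<in> V"
    then show "i \<noteq> j"
      unfolding V_def by (auto simp del: of_nat_Suc split: if_splits)
  next
    assume "i \<noteq> j"
    then show "inverse (real (Suc i)) \<in> V"
      unfolding V_def by (intro insertI2 range_eqI[of _ _ i]) simp
  qed
  have "closed ({p. age p c \<in> V} \<union> {p. age p c' \<in> V})"
    using closed_vimage[OF V continuous_age] by (intro closed_Un) (simp_all add: vimage_def)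
  moreover have "orbit_point g \<in> {p. age p c \<in> V} \<union> {p. age p c' \<in> V}" for g
  proof (rule ccontr)
    let ?u = "- g + c" and ?u' = "- g + c'"
    assume "orbit_point g \<notin> {p. age p c \<in> V} \<union> {p. age p c' \<in> V}"
    then have "age (orbit_point g) c \<notin> V" "age (orbit_point g) c' \<notin> V" by simp_all
    then have st: "stage ?u = j" "stage ?u' = j"
      unfolding age_orbit in_V by simp_all
    let ?f = "offset j ?u" and ?f' = "offset j ?u'"
    have f: "?f \<in> F j" "?u - ?f \<in> N j" "?f' \<in> F j" "?u' - ?f' \<in> N j"
      using offset[OF decided_stage, of ?u] offset[OF decided_stage, of ?u'] st by auto
    have "- (?u - ?f) + (?u' - ?f') \<in> N j"
      using f by (intro add_mem minus_mem)
    moreover have "- (?u - ?f) + (?u' - ?f') = (?f - c) - (?f' - c')"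
      by (simp add: diff_conv_add_uminus minus_add add.assoc del: add_uminus_conv_diff)
    ultimately show False using far[of ?f ?f'] f \<open>c \<noteq> c'\<close> by simp
  qed
  ultimately have "p \<in> {p. age p c \<in> V} \<union> {p. age p c' \<in> V}"
    using p by (rule pair_closure_minimal)
  then have "age p c \<in> V \<or> age p c' \<in> V" by simp
  then show ?thesis using age in_V[of j] by metis
qed

lemma closed_same_direction:
  "closed {p. norm (heading p h) = 1 \<and> norm (heading p h') = 1 \<and> direction p h = direction p h'}"
proof -
  define S where "S = {p. norm (heading p h) = 1} \<inter> {p. norm (heading p h') = 1}"
  have "closed S"
    unfolding S_def
    by (intro closed_Int closed_Collect_eq continuous_on_norm continuous_heading continuous_on_const)
  have "continuous_on S (\<lambda>p. direction p h'')" if "h'' \<in> {h, h'}" for h''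
    unfolding direction_def
    by (rule continuous_on_compose2[OF continuous_turn continuous_heading]) (use that in \<open>auto simp: S_def\<close>)
  then have "continuous_on S (\<lambda>p. direction p h - direction p h')"
    by (intro continuous_on_diff) auto
  then have "closed (S \<inter> (\<lambda>p. direction p h - direction p h') -` {0})"
    using \<open>closed S\<close> by (intro continuous_closed_preimage) auto
  also have "S \<inter> (\<lambda>p. direction p h - direction p h') -` {0}
      = {p. norm (heading p h) = 1 \<and> norm (heading p h') = 1 \<and> direction p h = direction p h'}"
    by (auto simp: S_def)
  finally show ?thesis .
qed

text \<open>On the orbit itself, among three positions of a fixed window that are all of large stage two lie
  in the same blob. Stated as ``one of them is old or two directions agree'', this is a closed
  condition, and holes are not old.\<close>
lemma two_directions:
  assumes p: "p \<in> pair_closure" and hole: "age p h1 = 0" "age p h2 = 0" "age p h3 = 0"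
  shows "direction p h1 = direction p h2 \<or> direction p h1 = direction p h3 \<or> direction p h2 = direction p h3"
proof -
  obtain k where k: "{h1, h2, h3} \<subseteq> window k" using window_exhausts[of "{h1, h2, h3}"] by auto
  define old where "old h = {p. inverse (real (Suc k)) \<le> age p h}" for h
  define same where "same h h' =
    {p. norm (heading p h) = 1 \<and> norm (heading p h') = 1 \<and> direction p h = direction p h'}" for h h'
  let ?A = "old h1 \<union> old h2 \<union> old h3 \<union> same h1 h2 \<union> same h1 h3 \<union> same h2 h3"
  have "closed (old h)" for h
    unfolding old_def by (intro closed_Collect_le continuous_on_const continuous_age)
  then have "closed ?A"
    using closed_same_direction by (intro closed_Un) (auto simp: same_def)
  moreover have "orbit_point g \<in> ?A" for g
  proof (cases "orbit_point g \<in> old h1 \<union> old h2 \<union> old h3")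
    case False
    define u where "u h = - g + h" for h
    have large: "k \<le> stage (u h)" if "h \<in> {h1, h2, h3}" for h
    proof -
      have "inverse (real (Suc (stage (u h)))) < inverse (real (Suc k))"
        using False that by (auto simp: old_def age_orbit u_def)
      then show ?thesis by simp
    qed
    have cut: "anchor (u a) = anchor (u b) \<or> anchor (u b) = anchor (u c)"
      if "a \<in> {h1, h2, h3}" "b \<in> {h1, h2, h3}" "c \<in> {h1, h2, h3}"
        "stage (u a) \<le> stage (u b)" "stage (u b) \<le> stage (u c)" for a b c
    proof (rule blob_cut_once)
      show "a \<in> window (stage (u a))" "b \<in> window (stage (u a))" "c \<in> window (stage (u a))"
        using that k window_mono[OF large[OF that(1)]] by auto
    qed (use that in \<open>auto simp: u_def diff_conv_add_uminus minus_add add.assoc simp del: add_uminus_conv_diff\<close>)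
    have "anchor (u h1) = anchor (u h2) \<or> anchor (u h1) = anchor (u h3) \<or> anchor (u h2) = anchor (u h3)"
    proof (cases rule: le_cases3[of "stage (u h1)" "stage (u h2)" "stage (u h3)"])
      case 1
      then show ?thesis using cut[of h1 h2 h3] by fastforce
    next
      case 2
      then show ?thesis using cut[of h2 h1 h3] by fastforce
    next
      case 3
      then show ?thesis using cut[of h1 h3 h2] by fastforce
    next
      case 4
      then show ?thesis using cut[of h3 h2 h1] by fastforce
    next
      case 5
      then show ?thesis using cut[of h2 h3 h1] by fastforce
    next
      case 6
      then show ?thesis using cut[of h3 h1 h2] by fastforce
    qed
    then have "direction (orbit_point g) h1 = direction (orbit_point g) h2 \<or>
        direction (orbit_point g) h1 = direction (orbit_point g) h3 \<or>
        direction (orbit_point g) h2 = direction (orbit_point g) h3"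
      unfolding direction_orbit u_def by auto
    then show ?thesis by (auto simp: same_def heading_orbit norm_turn)
  qed auto
  ultimately have "p \<in> ?A" using p by (rule pair_closure_minimal)
  moreover have "p \<notin> old h1 \<union> old h2 \<union> old h3" using hole by (auto simp: old_def)
  ultimately show ?thesis by (auto simp: same_def)
qed

definition pair_shift :: "'g \<Rightarrow> ('g \<Rightarrow> real \<times> complex) \<times> ('g \<Rightarrow> real \<times> complex) \<Rightarrow>
    ('g \<Rightarrow> real \<times> complex) \<times> ('g \<Rightarrow> real \<times> complex)" where
  "pair_shift g = (\<lambda>(x, y). (shift g x, shift g y))"

lemma age_pair_shift: "age (pair_shift g p) h = age p (- g + h)"
  by (simp add: age_def pair_shift_def shift_def case_prod_beta)

lemma heading_pair_shift: "heading (pair_shift g p) h = heading p (- g + h)"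
  by (simp add: heading_def pair_shift_def shift_def case_prod_beta)

lemma direction_pair_shift:
  assumes "p \<in> pair_closure"
  shows "direction (pair_shift g p) h = turn g (direction p (- g + h))"
proof -
  have "turn h (heading p (- g + h)) = turn (g + (- g + h)) (heading p (- g + h))" by simp
  also have "\<dots> = turn g (turn (- g + h) (heading p (- g + h)))"
    by (rule turn_add[OF norm_heading[OF assms]])
  finally show ?thesis by (simp add: direction_def heading_pair_shift)
qed

lemma continuous_pair_shift: "continuous_on S (pair_shift g)"
  unfolding pair_shift_def case_prod_beta
  by (intro continuous_on_Pair
      continuous_on_compose2[OF continuous_shift[of UNIV] continuous_on_fst[OF continuous_on_id]]
      continuous_on_compose2[OF continuous_shift[of UNIV] continuous_on_snd[OF continuous_on_id]]) auto

lemma pair_shift_pair_closure: "p \<in> pair_closure \<Longrightarrow> pair_shift g p \<in> pair_closure"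
proof -
  assume p: "p \<in> pair_closure"
  have "pair_shift g (orbit_point h) = orbit_point (g + h)" for h
    by (simp add: pair_shift_def orbit_point_def shift_add)
  then have "pair_shift g ` closure (range orbit_point) \<subseteq> closure (range orbit_point)"
    by (intro image_closure_subset[OF continuous_pair_shift]) (auto intro!: closure_subset[THEN subsetD])
  then show ?thesis using p by (auto simp: pair_closure_def)
qed

lemma pair_shift_pair_closure_iff: "pair_shift g p \<in> pair_closure \<longleftrightarrow> p \<in> pair_closure"
proof
  assume "pair_shift g p \<in> pair_closure"
  then have "pair_shift (- g) (pair_shift g p) \<in> pair_closure" by (rule pair_shift_pair_closure)
  moreover have "pair_shift (- g) (pair_shift g p) = p"
    by (simp add: pair_shift_def case_prod_beta flip: shift_add)
  ultimately show "p \<in> pair_closure" by simp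
qed (rule pair_shift_pair_closure)

end

text \<open>An invariant measure on the joint orbit closure of the two colourings. For \<open>SL(2, \<int>)\<close> acting on
  directions this context turns out to be inconsistent.\<close>
locale invariant_joining = turning_tower N F B turn + P: prob_space P
  for N :: "nat \<Rightarrow> 'g::{group_add, countable} set" and F B and turn :: "'g \<Rightarrow> complex \<Rightarrow> complex"
    and P :: "(('g \<Rightarrow> real \<times> complex) \<times> ('g \<Rightarrow> real \<times> complex)) measure" +
  assumes sets_P [measurable_cong]: "sets P = sets borel"
    and full: "emeasure P pair_closure = 1"
    and distr_pair_shift: "distr P borel (pair_shift g) = P"
begin

text \<open>The points whose random set of directions at holes meets \<open>C\<close>. Its probability is an invariant
  capacity on the circle.\<close>
definition hits :: "complex set \<Rightarrow> (('g \<Rightarrow> real \<times> complex) \<times> ('g \<Rightarrow> real \<times> complex)) set" where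
  "hits C = {p \<in> pair_closure. \<exists>h. age p h = 0 \<and> direction p h \<in> C}"

lemma space_P: "space P = UNIV"
  using sets_eq_imp_space_eq[OF sets_P] by simp

lemma measurable_pair_closure [measurable]: "pair_closure \<in> sets borel"
  by (simp add: pair_closure_def)

lemma measurable_age [measurable]: "(\<lambda>p. age p h) \<in> borel_measurable borel"
  by (rule borel_measurable_continuous_onI[OF continuous_age])

lemma measurable_direction [measurable]: "(\<lambda>p. direction p h) \<in> borel_measurable borel"
  unfolding direction_def
  by (rule measurable_compose[OF borel_measurable_continuous_onI[OF continuous_heading] measurable_turn])

lemma measurable_hits [measurable]:
  assumes [measurable]: "C \<in> sets borel"
  shows "hits C \<in> sets borel"
  unfolding hits_def by measurable

lemma prob_pair_shift:
  assumes "A \<in> sets borel"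
  shows "P.prob (pair_shift g -` A) = P.prob A"
proof -
  have "pair_shift g \<in> borel_measurable borel"
    by (rule borel_measurable_continuous_onI[OF continuous_pair_shift])
  then have "pair_shift g \<in> borel_measurable P" by measurable
  then have "measure (distr P borel (pair_shift g)) A = P.prob (pair_shift g -` A)"
    using assms by (subst measure_distr) (simp_all add: space_P)
  then show ?thesis by (simp add: distr_pair_shift)
qed

lemma prob_hits_turn:
  assumes "C \<in> sets borel"
  shows "P.prob (hits (turn g -` C)) = P.prob (hits C)"
proof -
  have "pair_shift g -` hits C = hits (turn g -` C)"
  proof (intro equalityI subsetI)
    fix p assume "p \<in> pair_shift g -` hits C"
    then show "p \<in> hits (turn g -` C)"
      by (auto simp: hits_def pair_shift_pair_closure_iff age_pair_shift direction_pair_shift)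
  next
    fix p assume "p \<in> hits (turn g -` C)"
    then obtain h where "p \<in> pair_closure" "age p h = 0" "turn g (direction p h) \<in> C"
      by (auto simp: hits_def)
    then show "p \<in> pair_shift g -` hits C"
      by (auto simp: hits_def pair_shift_pair_closure_iff age_pair_shift direction_pair_shift add.assoc[symmetric]
          intro!: exI[of _ "g + h"])
  qed
  then show ?thesis using prob_pair_shift[of "hits C" g] assms measurable_hits by simp
qed

lemma prob_hits_mono:
  assumes "C \<in> sets borel" "D \<in> sets borel" "C \<inter> sphere 0 1 \<subseteq> D"
  shows "P.prob (hits C) \<le> P.prob (hits D)"
proof (rule P.finite_measure_mono)
  show "hits C \<subseteq> hits D"
    using assms(3) norm_direction by (auto simp: hits_def subset_iff)
  show "hits D \<in> sets P" using assms measurable_hits sets_P by simp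
qed

text \<open>A set of at most two directions meets at most two of the disjoint sets.\<close>
lemma prob_hits_disjoint:
  fixes C :: "nat \<Rightarrow> complex set"
  assumes C: "\<And>i. C i \<in> sets borel" and disj: "disjoint_family C"
  shows "(\<Sum>i<K. P.prob (hits (C i))) \<le> 2"
proof -
  have [measurable]: "hits (C i) \<in> sets P" for i using C measurable_hits sets_P by simp
  have pt: "(\<Sum>i<K. indicator (hits (C i)) p) \<le> (2 :: real)" for p
  proof -
    define I where "I = {i \<in> {..<K}. p \<in> hits (C i)}"
    have "card I \<le> 2"
    proof (rule ccontr)
      assume "\<not> card I \<le> 2"
      then have "3 \<le> card I" by simp
      then obtain T where "T \<subseteq> I" "card T = 3" by (metis obtain_subset_with_card_n)
      then obtain i1 i2 i3 where i: "i1 \<in> I" "i2 \<in> I" "i3 \<in> I" "i1 \<noteq> i2" "i1 \<noteq> i3" "i2 \<noteq> i3"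
        by (auto simp: card_3_iff)
      then obtain h1 h2 h3 where p: "p \<in> pair_closure" "age p h1 = 0" "age p h2 = 0" "age p h3 = 0"
        and d: "direction p h1 \<in> C i1" "direction p h2 \<in> C i2" "direction p h3 \<in> C i3"
        by (auto simp: I_def hits_def)
      then show False
        using two_directions[OF p] i disj unfolding disjoint_family_on_def by (metis IntI UNIV_I empty_iff)
    qed
    moreover have "(\<Sum>i<K. indicator (hits (C i)) p :: real) = (\<Sum>i\<in>I. 1)"
      unfolding I_def sum.inter_filter[OF finite_lessThan] by (intro sum.cong) (auto simp: indicator_def)
    ultimately show ?thesis by simp
  qed
  have "(\<Sum>i<K. P.prob (hits (C i))) = P.expectation (\<lambda>p. \<Sum>i<K. indicator (hits (C i)) p)"
    by (subst Bochner_Integration.integral_sum) (auto simp: P.emeasure_eq_measure)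
  also have "\<dots> \<le> 2"
    by (rule P.integral_le_const) (use pt in \<open>auto intro!: Bochner_Integration.integrable_sum simp: P.emeasure_eq_measure\<close>)
  finally show ?thesis .
qed

text \<open>By invariance all positions have stage \<open>j\<close> with the same probability, and at most one of the
  \<open>2 ^ (j + 2)\<close> positions in \<open>C\<close> can have stage \<open>j\<close>.\<close>
lemma prob_age_le: "P.prob {p \<in> pair_closure. age p 0 = inverse (real (Suc j))} \<le> 1 / 2 ^ (j + 2)"
proof -
  obtain C where C: "finite C" "card C = 2 ^ (j + 2)"
    and spread: "\<forall>c\<in>C. \<forall>c'\<in>C. \<forall>f\<in>F j. \<forall>f'\<in>F j. (f - c) - (f' - c') \<in> N j \<longrightarrow> c = c'"
    using sparse[of j] by (elim exE conjE)
  have far: "c = c'" if "c \<in> C" "c' \<in> C" "f \<in> F j" "f' \<in> F j" "(f - c) - (f' - c') \<in> N j" for c c' f f'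
    using bspec[OF bspec[OF bspec[OF bspec[OF spread that(1)] that(2)] that(3)] that(4)] that(5) by (rule mp)
  define E where "E c = {p \<in> pair_closure. age p c = inverse (real (Suc j))}" for c
  have E_meas: "E c \<in> sets borel" for c
    unfolding E_def by measurable
  have "pair_shift (- c) -` E 0 = E c" for c
    by (auto simp: E_def age_pair_shift pair_shift_pair_closure_iff)
  then have eq: "P.prob (E c) = P.prob (E 0)" for c
    using prob_pair_shift[OF E_meas, of "- c" 0] by simp
  have "disjoint_family_on E C"
    unfolding disjoint_family_on_def
  proof (intro ballI impI)
    fix c c' assume c: "c \<in> C" "c' \<in> C" "c \<noteq> c'"
    show "E c \<inter> E c' = {}"
    proof (rule ccontr)
      assume "E c \<inter> E c' \<noteq> {}"
      then obtain p where "p \<in> pair_closure" "age p c = inverse (real (Suc j))"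
          "age p c' = inverse (real (Suc j))"
        unfolding E_def by blast
      then show False using age_sparse[of p c c' j] far[OF c(1,2)] c(3) by metis
    qed
  qed
  then have "(\<Sum>c\<in>C. P.prob (E c)) = P.prob (\<Union>c\<in>C. E c)"
    using C(1) E_meas sets_P by (intro P.finite_measure_finite_Union[symmetric]) auto
  also have "\<dots> \<le> 1" by simp
  also have "(\<Sum>c\<in>C. P.prob (E c)) = (\<Sum>c\<in>C. P.prob (E 0))"
    by (intro sum.cong refl eq)
  finally have "2 ^ (j + 2) * P.prob (E 0) \<le> 1" using C(2) by simp
  then show ?thesis by (simp add: E_def field_simps)
qed

lemma prob_hits_UNIV: "P.prob (hits UNIV) \<ge> 1 / 2"
proof -
  define E where "E j = {p \<in> pair_closure. age p 0 = inverse (real (Suc j))}" for j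
  have E: "E j \<in> sets P" for j
    unfolding E_def sets_P by measurable
  have geometric: "summable (\<lambda>j. (1 / 2 :: real) ^ (j + 2))"
    by (subst summable_iff_shift) (auto intro!: summable_geometric)
  have le: "P.prob (E j) \<le> (1 / 2) ^ (j + 2)" for j
    using prob_age_le[of j] by (simp add: E_def power_one_over)
  have summable: "summable (\<lambda>j. P.prob (E j))"
    by (rule summable_comparison_test'[OF geometric, of 0]) (use le in auto)
  have "pair_closure \<subseteq> (\<Union>j. E j) \<union> hits UNIV"
  proof
    fix p assume "p \<in> pair_closure"
    then show "p \<in> (\<Union>j. E j) \<union> hits UNIV"
      using age_values[of p 0] unfolding E_def hits_def by blast
  qed
  moreover have H: "hits UNIV \<in> sets P" unfolding sets_P by measurable
  ultimately have "P.prob pair_closure \<le> P.prob ((\<Union>j. E j) \<union> hits UNIV)"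
    using E by (intro P.finite_measure_mono) auto
  also have "\<dots> \<le> P.prob (\<Union>j. E j) + P.prob (hits UNIV)"
    using E H by (intro measure_Un_le) auto
  also have "P.prob (\<Union>j. E j) \<le> (\<Sum>j. P.prob (E j))"
    using E summable by (intro P.finite_measure_subadditive_countably) auto
  also have "(\<Sum>j. P.prob (E j)) \<le> (\<Sum>j. (1 / 2) ^ (j + 2))"
    by (intro suminf_le le summable geometric)
  also have "(\<Sum>j. (1 / 2 :: real) ^ (j + 2)) = 1 / 2"
  proof -
    have "(\<lambda>j. (1 / 4) * (1 / 2 :: real) ^ j) sums ((1 / 4) * (1 / (1 - 1 / 2)))"
      by (intro sums_mult geometric_sums) simp
    then have "(\<lambda>j. (1 / 2 :: real) ^ (j + 2)) sums (1 / 2)" by (simp add: power_add mult.commute power2_eq_square)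
    then show ?thesis by (rule sums_unique[symmetric])
  qed
  finally have "P.prob pair_closure \<le> 1 / 2 + P.prob (hits UNIV)" by simp
  then show ?thesis using full by (simp add: P.emeasure_eq_measure)
qed

end

section \<open>The group SL(2, Z) acting on directions\<close>

text \<open>The class \<open>group_add\<close> does not require commutativity; it is used here as the class of
  groups, so that \<open>x + y\<close> is the matrix product.\<close>
typedef sl2 = "{(a, b, c, d). a * d - b * c = (1 :: int)}"
  morphisms entries of_entries
  by (rule exI[of _ "(1, 0, 0, 1)"]) simp

lemma sl2_cases:
  obtains a b c d where "entries x = (a, b, c, d)" "a * d - b * c = 1"
proof -
  obtain a b c d where "entries x = (a, b, c, d)" by (metis prod_cases4)
  then show ?thesis using that entries[of x] by auto
qed

instance sl2 :: countable
proof (rule countable_classI[of "\<lambda>x. to_nat (entries x)"])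
  fix x y :: sl2 assume "to_nat (entries x) = to_nat (entries y)"
  then show "x = y" by (simp add: entries_inject)
qed

instantiation sl2 :: group_add
begin

definition zero_sl2 :: sl2 where "0 = of_entries (1, 0, 0, 1)"

definition plus_sl2 :: "sl2 \<Rightarrow> sl2 \<Rightarrow> sl2" where
  "x + y = (case (entries x, entries y) of ((a, b, c, d), (a', b', c', d')) \<Rightarrow>
     of_entries (a * a' + b * c', a * b' + b * d', c * a' + d * c', c * b' + d * d'))"

definition uminus_sl2 :: "sl2 \<Rightarrow> sl2" where
  "- x = (case entries x of (a, b, c, d) \<Rightarrow> of_entries (d, - b, - c, a))"

definition minus_sl2 :: "sl2 \<Rightarrow> sl2 \<Rightarrow> sl2" where
  "x - y = x + - (y :: sl2)"

lemma entries_zero: "entries 0 = (1, 0, 0, 1)"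
  unfolding zero_sl2_def by (rule of_entries_inverse) simp

lemma entries_plus:
  assumes "entries x = (a, b, c, d)" "entries y = (a', b', c', d')"
  shows "entries (x + y) = (a * a' + b * c', a * b' + b * d', c * a' + d * c', c * b' + d * d')"
proof -
  have "a * d - b * c = 1" "a' * d' - b' * c' = 1"
    using entries[of x] entries[of y] assms by auto
  then have "(a * a' + b * c') * (c * b' + d * d') - (a * b' + b * d') * (c * a' + d * c') = 1"
    by algebra
  then show ?thesis
    unfolding plus_sl2_def assms by (simp add: of_entries_inverse)
qed

lemma entries_uminus:
  assumes "entries x = (a, b, c, d)"
  shows "entries (- x) = (d, - b, - c, a)"
proof -
  have "a * d - b * c = 1" using entries[of x] assms by auto
  then show ?thesis
    unfolding uminus_sl2_def assms by (simp add: of_entries_inverse mult.commute)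
qed

instance
proof
  fix x y z :: sl2
  obtain a b c d where x: "entries x = (a, b, c, d)" and det: "a * d - b * c = 1" by (rule sl2_cases)
  obtain a' b' c' d' where y: "entries y = (a', b', c', d')" by (rule sl2_cases)
  obtain a'' b'' c'' d'' where z: "entries z = (a'', b'', c'', d'')" by (rule sl2_cases)
  show "x + y + z = x + (y + z)"
    unfolding entries_inject[symmetric] entries_plus[OF entries_plus[OF x y] z]
      entries_plus[OF x entries_plus[OF y z]] by (simp add: algebra_simps)
  show "0 + x = x" "x + 0 = x"
    unfolding entries_inject[symmetric] entries_plus[OF x entries_zero] entries_plus[OF entries_zero x]
    by (simp_all add: x)
  show "- x + x = 0"
    unfolding entries_inject[symmetric] entries_plus[OF entries_uminus[OF x] x] entries_zero
    using det by (simp add: algebra_simps)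
  show "x + - y = x - y" by (simp add: minus_sl2_def)
qed

end

lemma infinite_sl2: "infinite (UNIV :: sl2 set)"
proof -
  have "entries (of_entries (1, int n, 0, 1)) = (1, int n, 0, 1)" for n
    by (rule of_entries_inverse) simp
  then have "inj (\<lambda>n. of_entries (1, int n, 0, 1))"
    by (intro injI) (metis Pair_inject of_nat_eq_iff)
  then show ?thesis
    using finite_imageD[of "\<lambda>n. of_entries (1, int n, 0, 1)" UNIV] finite_subset[OF subset_UNIV] by blast
qed

definition congruence_subgroup :: "nat \<Rightarrow> sl2 set" where
  "congruence_subgroup j = {x. case entries x of (a, b, c, d) \<Rightarrow>
     [a = 1] (mod 2 ^ j) \<and> [b = 0] (mod 2 ^ j) \<and> [c = 0] (mod 2 ^ j) \<and> [d = 1] (mod 2 ^ j)}"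

definition reduce :: "nat \<Rightarrow> sl2 \<Rightarrow> int \<times> int \<times> int \<times> int" where
  "reduce j x = (case entries x of (a, b, c, d) \<Rightarrow> (a mod 2 ^ j, b mod 2 ^ j, c mod 2 ^ j, d mod 2 ^ j))"

lemma diff_congruence_subgroup:
  assumes "reduce j x = reduce j y"
  shows "x - y \<in> congruence_subgroup j"
proof -
  obtain a b c d where x: "entries x = (a, b, c, d)" and det: "a * d - b * c = 1" by (rule sl2_cases)
  obtain a' b' c' d' where y: "entries y = (a', b', c', d')" by (rule sl2_cases)
  have cong: "[a' = a] (mod 2 ^ j)" "[b' = b] (mod 2 ^ j)" "[c' = c] (mod 2 ^ j)" "[d' = d] (mod 2 ^ j)"
    using assms by (auto simp: reduce_def x y cong_def)
  have "entries (x - y) = (a * d' + b * - c', a * - b' + b * a', c * d' + d * - c', c * - b' + d * a')"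
    unfolding minus_sl2_def by (rule entries_plus[OF x entries_uminus[OF y]])
  moreover have "[a * d' + b * - c' = a * d + b * - c] (mod 2 ^ j)"
    "[a * - b' + b * a' = a * - b + b * a] (mod 2 ^ j)"
    "[c * d' + d * - c' = c * d + d * - c] (mod 2 ^ j)"
    "[c * - b' + d * a' = c * - b + d * a] (mod 2 ^ j)"
    using cong by (intro cong_add cong_mult cong_refl; simp add: cong_minus_minus_iff)+
  moreover have "a * d + b * - c = 1" "a * - b + b * a = 0" "c * d + d * - c = 0" "c * - b + d * a = 1"
    using det by (simp_all add: algebra_simps)
  ultimately show ?thesis by (simp add: congruence_subgroup_def)
qed

lemma congruence_subgroup_iff: "x \<in> congruence_subgroup j \<longleftrightarrow> reduce j x = reduce j 0"
  by (cases "entries x") (simp add: congruence_subgroup_def reduce_def entries_zero cong_def)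

lemma residual_chain_sl2: "residual_chain congruence_subgroup"
proof
  show "0 \<in> congruence_subgroup j" for j by (simp add: congruence_subgroup_iff)
  show "x - y \<in> congruence_subgroup j" if "x \<in> congruence_subgroup j" "y \<in> congruence_subgroup j" for x y j
    using that by (intro diff_congruence_subgroup) (simp add: congruence_subgroup_iff)
  show "congruence_subgroup (Suc j) \<subseteq> congruence_subgroup j" for j
    by (auto simp: congruence_subgroup_def intro: cong_modulus_mult[of _ _ "2 ^ j" 2] simp: mult.commute
        split: prod.splits)
  show "\<exists>R. finite R \<and> (\<forall>g. \<exists>r\<in>R. g - r \<in> congruence_subgroup j)" for j
  proof -
    have "range (reduce j) \<subseteq> {0..<2 ^ j} \<times> {0..<2 ^ j} \<times> {0..<2 ^ j} \<times> {0..<2 ^ j}"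
      by (auto simp: reduce_def split: prod.splits)
    then have "finite (range (reduce j))" by (rule finite_subset) simp
    moreover have "\<exists>r\<in>inv_into UNIV (reduce j) ` range (reduce j). g - r \<in> congruence_subgroup j" for g
      by (intro bexI[of _ "inv_into UNIV (reduce j) (reduce j g)"] diff_congruence_subgroup)
        (simp_all add: f_inv_into_f)
    ultimately show ?thesis by blast
  qed
  show "\<exists>j. g \<notin> congruence_subgroup j" if "g \<noteq> 0" for g
  proof (rule ccontr)
    assume "\<nexists>j. g \<notin> congruence_subgroup j"
    then have all: "g \<in> congruence_subgroup j" for j by blast
    obtain a b c d where g: "entries g = (a, b, c, d)" by (rule sl2_cases)
    have eq: "u = v" if "\<And>j. [u = v] (mod 2 ^ j)" for u v :: int
    proof (rule ccontr)
      assume "u \<noteq> v"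
      let ?j = "nat \<bar>u - v\<bar>"
      have "2 ^ ?j dvd u - v" using that by (simp add: cong_iff_dvd_diff)
      then have "\<bar>2 ^ ?j\<bar> \<le> \<bar>u - v\<bar>" using \<open>u \<noteq> v\<close> by (intro dvd_imp_le_int) auto
      moreover have "int ?j < 2 ^ ?j" by (rule of_nat_less_two_power)
      ultimately show False by simp
    qed
    have "a = 1" "b = 0" "c = 0" "d = 1"
      using all by (auto intro!: eq simp: congruence_subgroup_def g)
    then have "g = 0" using g entries_zero entries_inject by metis
    then show False using that by simp
  qed
qed (rule infinite_sl2)

definition mat_vec :: "sl2 \<Rightarrow> complex \<Rightarrow> complex" where
  "mat_vec g z = (case entries g of (a, b, c, d) \<Rightarrow>
     Complex (of_int a * Re z + of_int b * Im z) (of_int c * Re z + of_int d * Im z))"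

text \<open>Unit vectors stand for the rays of the plane; \<open>sgn\<close> projects back to the unit circle.\<close>
definition turn :: "sl2 \<Rightarrow> complex \<Rightarrow> complex" where
  "turn g z = sgn (mat_vec g z)"

lemma mat_vec_zero: "mat_vec 0 z = z"
  by (simp add: mat_vec_def entries_zero)

lemma mat_vec_add: "mat_vec (g + h) z = mat_vec g (mat_vec h z)"
proof -
  obtain a b c d where x: "entries g = (a, b, c, d)" by (rule sl2_cases)
  obtain a' b' c' d' where y: "entries h = (a', b', c', d')" by (rule sl2_cases)
  show ?thesis by (simp add: mat_vec_def entries_plus[OF x y] x y algebra_simps)
qed

lemma mat_vec_scaleR: "mat_vec g (r *\<^sub>R z) = r *\<^sub>R mat_vec g z"
  by (cases "entries g") (simp add: mat_vec_def complex_eq_iff algebra_simps)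

lemma mat_vec_eq_0_iff: "mat_vec g z = 0 \<longleftrightarrow> z = 0"
proof
  assume "mat_vec g z = 0"
  then have "mat_vec (- g) (mat_vec g z) = 0"
    using mat_vec_scaleR[of "- g" 0 0] by simp
  then show "z = 0" by (simp add: mat_vec_zero flip: mat_vec_add)
qed (use mat_vec_scaleR[of g 0 0] in simp)

lemma continuous_mat_vec: "continuous_on S (mat_vec g)"
proof -
  obtain a b c d where g: "entries g = (a, b, c, d)" by (rule sl2_cases)
  show ?thesis
    unfolding mat_vec_def[abs_def] g prod.case Complex_eq
    by (intro continuous_intros)
qed

lemma turn_properties:
  shows "norm z = 1 \<Longrightarrow> turn 0 z = z"
    and "turn (g + h) z = turn g (turn h z)"
    and "norm z = 1 \<Longrightarrow> norm (turn g z) = 1"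
    and "continuous_on (sphere 0 1) (turn g)"
    and "turn g \<in> borel_measurable borel"
proof -
  show "norm z = 1 \<Longrightarrow> turn 0 z = z"
    by (simp add: turn_def mat_vec_zero sgn_div_norm)
  show "turn (g + h) z = turn g (turn h z)"
  proof (cases "z = 0")
    case True
    then show ?thesis using mat_vec_eq_0_iff[THEN iffD2] by (simp add: turn_def)
  next
    case False
    then have "mat_vec h z \<noteq> 0" by (simp add: mat_vec_eq_0_iff)
    then show ?thesis
      by (simp add: turn_def mat_vec_add sgn_div_norm[of "mat_vec h z"] mat_vec_scaleR sgn_scaleR)
  qed
  show "norm z = 1 \<Longrightarrow> norm (turn g z) = 1"
    using mat_vec_eq_0_iff[of g z] by (auto simp: turn_def norm_sgn)
  show "continuous_on (sphere 0 1) (turn g)"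
    unfolding turn_def[abs_def] by (intro continuous_on_sgn continuous_mat_vec) (auto simp: mat_vec_eq_0_iff)
  have "mat_vec g \<in> borel_measurable borel"
    by (rule borel_measurable_continuous_onI[OF continuous_mat_vec])
  then show "turn g \<in> borel_measurable borel"
    unfolding turn_def[abs_def] sgn_div_norm by measurable
qed

definition shear :: sl2 where "shear = of_entries (1, 1, 0, 1)"

definition quarter_turn :: sl2 where "quarter_turn = of_entries (0, -1, 1, 0)"

text \<open>The shear adds \<open>1\<close> to \<open>Re z / Im z\<close>, so it shifts the sectors by one.\<close>
definition sector :: "int \<Rightarrow> complex set" where
  "sector n = {z. Im z \<noteq> 0 \<and> \<lfloor>Re z / Im z\<rfloor> = n}"

lemma turn_shear_sector: "turn shear -` sector (n + 1) = sector n"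
proof -
  have "entries shear = (1, 1, 0, 1)"
    unfolding shear_def by (rule of_entries_inverse) simp
  then have lin: "mat_vec shear z = Complex (Re z + Im z) (Im z)" for z by (simp add: mat_vec_def)
  have scale: "sgn w \<in> sector m \<longleftrightarrow> w \<in> sector m" for w m
    by (cases "w = 0") (simp_all add: sector_def sgn_div_norm)
  have "(Re z + Im z) / Im z = Re z / Im z + 1" if "Im z \<noteq> 0" for z
    using that by (simp add: add_divide_distrib)
  then show ?thesis
    by (auto simp: turn_def scale lin) (auto simp: sector_def)
qed

lemma sector_measurable: "sector n \<in> sets borel"
  unfolding sector_def by measurable

lemma no_invariant_joining:
  assumes "invariant_joining N F B turn P"
  shows False
proof -
  interpret invariant_joining N F B turn P by fact
  let ?e = "\<lambda>C. P.prob (hits C)"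
  have step: "?e (sector (n + 1)) = ?e (sector n)" for n
    using prob_hits_turn[OF sector_measurable, of shear "n + 1"] by (simp add: turn_shear_sector)
  have const: "?e (sector (m + int i)) = ?e (sector m)" for m i
  proof (induction i)
    case (Suc i)
    have "?e (sector (m + int (Suc i))) = ?e (sector ((m + int i) + 1))"
      by (simp add: ac_simps)
    then show ?case using step[of "m + int i"] Suc by simp
  qed simp
  have zero: "?e (sector m) = 0" for m
  proof (rule ccontr)
    assume "?e (sector m) \<noteq> 0"
    then have pos: "?e (sector m) > 0" by (simp add: zero_less_measure_iff)
    obtain K :: nat where K: "2 < real K * ?e (sector m)" using reals_Archimedean3[OF pos] by blast
    have "disjoint_family (\<lambda>i. sector (m + int i))"
      by (auto simp: disjoint_family_on_def sector_def)
    then have "(\<Sum>i<K. ?e (sector (m + int i))) \<le> 2"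
      using sector_measurable by (intro prob_hits_disjoint) auto
    then show False using K by (simp add: const)
  qed
  define upright where "upright = {z. Im z \<noteq> 0}"
  define level where "level = {z. Im z = 0}"
  have meas: "upright \<in> sets borel" "level \<in> sets borel" "{z. Re z = 0} \<in> sets borel"
    unfolding upright_def level_def by measurable
  have "hits upright = (\<Union>m. hits (sector m))"
    by (auto simp: hits_def upright_def sector_def)
  also have "P.prob \<dots> = 0"
  proof -
    have "(\<Union>m. hits (sector m)) \<in> null_sets P"
      using zero measurable_hits[OF sector_measurable]
      by (intro null_sets_UN) (auto simp: null_sets_def P.emeasure_eq_measure sets_P)
    then show ?thesis by (simp add: null_sets_def P.emeasure_eq_measure)
  qed
  finally have up: "?e upright = 0" .
  have quarter: "turn quarter_turn -` level = {z. Re z = 0}"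
  proof -
    have "entries quarter_turn = (0, -1, 1, 0)"
      unfolding quarter_turn_def by (rule of_entries_inverse) simp
    then have "mat_vec quarter_turn z = Complex (- Im z) (Re z)" for z by (simp add: mat_vec_def)
    then show ?thesis
      by (auto simp: turn_def level_def sgn_div_norm complex_eq_iff)
  qed
  have "?e level = ?e {z. Re z = 0}"
    using prob_hits_turn[OF meas(2), of quarter_turn] quarter by simp
  also have "\<dots> \<le> ?e upright"
    by (rule prob_hits_mono[OF meas(3,1)]) (auto simp: upright_def cmod_def)
  finally have lev: "?e level = 0" using up by (simp add: measure_le_0_iff)
  have "hits UNIV = hits upright \<union> hits level"
    by (auto simp: hits_def upright_def level_def)
  then have "?e UNIV \<le> ?e upright + ?e level"
    using meas measurable_hits by (auto intro!: measure_Un_le simp: sets_P)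
  then show False using prob_hits_UNIV up lev by simp
qed

text \<open>All real coordinates of a colouring, enumerated. Indices \<open>(h, i)\<close> with \<open>i > 2\<close> repeat a coordinate.\<close>
definition embed :: "(sl2 \<Rightarrow> real \<times> complex) \<Rightarrow> nat \<Rightarrow> real" where
  "embed x n = (case from_nat n :: sl2 \<times> nat of (h, i) \<Rightarrow>
     (if i = 0 then fst (x h) else if i = 1 then Re (snd (x h)) else Im (snd (x h))))"

lemma continuous_embed: "continuous_on UNIV embed"
proof (rule continuous_on_coordinatewise_then_product)
  fix n
  obtain h i where "from_nat n = (h :: sl2, i :: nat)" by (cases "from_nat n :: sl2 \<times> nat")
  then show "continuous_on UNIV (\<lambda>x. embed x n)"
    unfolding embed_def
    by (cases "i = 0"; cases "i = 1")
      (simp_all, (intro continuous_on_fst continuous_on_Re continuous_on_Im continuous_on_snd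
        continuous_on_coordinate)+)
qed

lemma inj_embed: "inj embed"
proof (rule injI, rule ext)
  fix x y :: "sl2 \<Rightarrow> real \<times> complex" and h :: sl2
  assume "embed x = embed y"
  then have "embed x (to_nat (h, i)) = embed y (to_nat (h, i))" for i :: nat by simp
  from this[of 0] this[of 1] this[of 2] show "x h = y h"
    by (simp add: embed_def prod_eq_iff complex_eq_iff)
qed

theorem propositionA4:
  shows "\<exists>(G :: real monoid) (X :: (nat \<Rightarrow> real) topology) (\<phi> :: real \<Rightarrow> (nat \<Rightarrow> real) \<Rightarrow> (nat \<Rightarrow> real)).
    flow G X \<phi> \<and>
    metrizable_space X \<and>
    hereditarily_amenable_flow G X \<phi> \<and>
    \<not> amenable_flow G (enveloping_topology G X \<phi>) (enveloping_action G X \<phi>)"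
proof -
  obtain N :: "nat \<Rightarrow> sl2 set" and F B where "blob_tower N F B"
    using residual_chain.blob_tower_exists[OF residual_chain_sl2] by blast
  then interpret turning_tower N F B turn
    by (intro turning_tower.intro turning_tower_axioms.intro turn_properties)
  let ?S = "orbit_closure True \<union> orbit_closure False"
  interpret embedded_action shift embed ?S
  proof
    show "compact ?S" by (intro compact_Un compact_orbit_closure)
  qed (auto simp: shift_add continuous_shift continuous_embed inj_embed shift_orbit_closure)
  have "hereditarily_amenable_flow coded_group coded_space coded_action"
    by (rule hereditarily_amenable_coded) (rule invariant_measure_subflow)
  moreover have "\<not> amenable_flow coded_group (enveloping_topology coded_group coded_space coded_action)
      (enveloping_action coded_group coded_space coded_action)"
  proof (rule not_amenable_enveloping)
    show "base True \<in> ?S" "base False \<in> ?S" using base_in_orbit_closure by auto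
    fix P :: "((sl2 \<Rightarrow> real \<times> complex) \<times> (sl2 \<Rightarrow> real \<times> complex)) measure"
    assume P: "prob_space P" "sets P = sets borel"
      "emeasure P (closure (range (\<lambda>g. (shift g (base True), shift g (base False))))) = 1"
      "\<And>g. distr P borel (\<lambda>(x, y). (shift g x, shift g y)) = P"
    have "invariant_joining N F B turn P"
      using P by (intro invariant_joining.intro turning_tower_axioms invariant_joining_axioms.intro)
        (simp_all add: turning_tower_axioms pair_closure_def orbit_point_def[abs_def] pair_shift_def)
    then show False by (rule no_invariant_joining)
  qed
  ultimately show ?thesis using flow_coded metrizable_coded by blast
qed

end
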